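(* Let $U_-,U_+\in\mathbb{R}$ with $U_-<U_+$, and let $D\in C^0(\mathbb{R})$ be nonnegative and bounded. Then the unique stationary profile $U:\mathbb{R}\to\mathbb{R}$ for $D$ and $(U_-,U_+)$ is nondecreasing, and hence depends only on the restriction $D|_{[U_-,U_+]}$ (i.e. two such functions $D$ agreeing on $[U_-,U_+]$ have the same profile).
   Context: For $U_-,U_+\in\mathbb{R}$ let $\overline u_\pm(y)=U_-$ for $y<0$ and $\overline u_\pm(y)=U_+$ for $y>0$. Let $A(u)=\int_0^uD(s)\,ds$. A stationary profile is a function $U\in L^2_{\mathrm{loc}}(\mathbb{R})$ for which there is $v\in H^1(\mathbb{R})$ with $U=\overline u_\pm+v'$ and $$\int_{\mathbb{R}}\Big(A(U(y))\,\psi''(y)-U(y)\big(\tfrac y2\psi(y)\big)'\Big)\,dy=0\quad\text{for all }\psi\in C^2_c(\mathbb{R}).$$ This is the weak form of $(D(U)U')'+\frac y2U'=0$ on $\mathbb{R}$, $U(\pm\infty)=U_\pm$. For nonnegative bounded continuous $D$ such a profile exists and is unique. "Nondecreasing" is understood up to modification on a null set, since $U$ may be discontinuous when $D$ degenerates. *)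

theory Defs
  imports "HOL-Analysis.Analysis"
begin

text \<open>
  Elements of $L^2$, $L^2_{loc}$ and $H^1$ are represented by functions on the reals, measurable
  with respect to the completed measure \<^term>\<open>lebesgue\<close>, so that all notions below are invariant
  under modification on an arbitrary null set.
\<close>

definition L2_on :: "real set \<Rightarrow> (real \<Rightarrow> real) \<Rightarrow> bool" where
  "L2_on S f \<longleftrightarrow>
     set_borel_measurable lebesgue S f \<and> set_integrable lebesgue S (\<lambda>x. (f x)\<^sup>2)"

definition L2_loc :: "(real \<Rightarrow> real) \<Rightarrow> bool" where
  "L2_loc f \<longleftrightarrow> (\<forall>K. compact K \<longrightarrow> L2_on K f)"

definition Cc :: "nat \<Rightarrow> (real \<Rightarrow> real) set" where
  "Cc k = {\<psi>. (\<forall>j<k. (deriv ^^ j) \<psi> differentiable_on UNIV) \<and>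
              continuous_on UNIV ((deriv ^^ k) \<psi>) \<and>
              compact (closure {x. \<psi> x \<noteq> 0})}"

text \<open>
  \<open>H1_deriv v w\<close>: the function \<open>v\<close> belongs to $H^1$ of the real line and \<open>w\<close> is (a representative
  of) its weak derivative. As in Brezis' textbook, the test functions are those in $C^1_c$.
\<close>

definition H1_deriv :: "(real \<Rightarrow> real) \<Rightarrow> (real \<Rightarrow> real) \<Rightarrow> bool" where
  "H1_deriv v w \<longleftrightarrow> L2_on UNIV v \<and> L2_on UNIV w \<and>
     (\<forall>\<phi>\<in>Cc 1. (LINT x|lebesgue. v x * deriv \<phi> x) = - (LINT x|lebesgue. w x * \<phi> x))"

text \<open>The value at \<open>0\<close> is immaterial.\<close>

definition ubar :: "real \<Rightarrow> real \<Rightarrow> real \<Rightarrow> real" where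
  "ubar Um Up y = (if y < 0 then Um else Up)"

text \<open>The interval integral is oriented, hence the formula is also right for negative \<open>u\<close>.\<close>

definition primitive :: "(real \<Rightarrow> real) \<Rightarrow> real \<Rightarrow> real" where
  "primitive D u = (LBINT s=0..ereal u. D s)"

definition stationary_profile ::
    "(real \<Rightarrow> real) \<Rightarrow> real \<Rightarrow> real \<Rightarrow> (real \<Rightarrow> real) \<Rightarrow> bool" where
  "stationary_profile D Um Up U \<longleftrightarrow>
     L2_loc U \<and>
     (\<exists>v v'. H1_deriv v v' \<and> (AE y in lebesgue. U y = ubar Um Up y + v' y)) \<and>
     (\<forall>\<psi>\<in>Cc 2. (LINT y|lebesgue. primitive D (U y) * deriv (deriv \<psi>) y
                     - U y * deriv (\<lambda>z. z / 2 * \<psi> z) y) = 0)"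

definition ae_nondecreasing :: "(real \<Rightarrow> real) \<Rightarrow> bool" where
  "ae_nondecreasing U \<longleftrightarrow> (\<exists>V. mono V \<and> (AE y in lebesgue. U y = V y))"

definition admissible :: "(real \<Rightarrow> real) \<Rightarrow> bool" where
  "admissible D \<longleftrightarrow> continuous_on UNIV D \<and> (\<forall>s. 0 \<le> D s) \<and> bounded (range D)"

end

theory Submission
  imports Defs
begin


text \<open>
  Write \<open>A\<close> for the primitive of \<open>D\<close>. Two applications of the du Bois-Reymond lemma turn the weak equation
  into a first-order system: \<open>A(U)\<close> agrees almost everywhere with a continuous function \<open>W\<close>, and there
  is a continuous \<open>F\<close> with
  \[ W' = F - \frac s2 U, \qquad F' = \frac12 U, \]
  both equations being integrated ones (\<^term>\<open>ac_primitive\<close>). The arguments below combine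
  this flux form with the monotonicity of \<open>A\<close> and with square integrability near \<open>\<plusminus>\<infinity>\<close>.
  
  \<^emph>\<open>Monotonicity of \<open>W\<close>.\<close> If \<open>W\<close> decreased somewhere, the mean value theorem would give a value \<open>k\<close> of the
  range in question with \<open>D k > 0\<close>. Such a level is regular: \<open>A u = A k\<close> forces \<open>u = k\<close>, so \<open>U\<close> is continuous
  where \<open>W = A k\<close>, and there \<open>W\<close> is differentiable with \<open>W' = F - s k / 2\<close>. Put \<open>H = F - s k / 2\<close>, so
  \<open>H' = (U - k) / 2\<close>. On a bounded component \<open>(a, b)\<close> of \<open>{W > A k}\<close> one has \<open>U > k\<close>, hence \<open>H b > H a\<close>; but
  \<open>H a = W' a \<ge> 0 \<ge> W' b = H b\<close>. Bounded components of \<open>{W < A k}\<close> are excluded in the same way. A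
  component reaching \<open>-\<infinity>\<close> on which \<open>U > k > U\<^sub>-\<close>, or one reaching \<open>+\<infinity>\<close> on which \<open>U < k < U\<^sub>+\<close>,
  contradicts square integrability, and since \<open>U\<^sub>- < U\<^sub>+\<close> one of the two alternatives \<open>k > U\<^sub>-\<close>,
  \<open>k < U\<^sub>+\<close> always holds.
  
  \<^emph>\<open>Monotonicity of \<open>U\<close>.\<close> Where \<open>W\<close> increases strictly, so does \<open>U\<close>. On a plateau of \<open>W\<close> the equation says
  \<open>F = s U / 2\<close> and \<open>F' = U / 2\<close>, so \<open>F / s\<close>, and with it \<open>U\<close>, is constant on either side of the origin. A
  downward jump of \<open>U\<close> at the origin would force \<open>W\<close> to decrease just beyond the end of the plateau; and if
  the plateau is infinite to both sides, the two constants are \<open>U\<^sub>- < U\<^sub>+\<close>.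
  
  \<^emph>\<open>Uniqueness.\<close> For two profiles let \<open>w = U\<^sub>1 - U\<^sub>2\<close>, \<open>G = W\<^sub>1 - W\<^sub>2\<close> and let \<open>z\<close> be the \<open>H\<^sup>1\<close> function with
  \<open>z' = w\<close>. The flux forms give \<open>G' = z / 2 - s w / 2\<close>, so
  \[ \Big(z G + \frac s4 z^2\Big)' = w G + \frac34 z^2 \ge 0 . \]
  The function in parentheses is monotone, and because \<open>z\<close> and \<open>G\<close> are square integrable it can be neither
  eventually positive nor initially negative. Hence it vanishes, and so do \<open>z\<close> and \<open>w\<close>.
  
  \<^emph>\<open>Dependence on \<open>D\<close>.\<close> A nondecreasing profile takes values in \<open>[U\<^sub>-, U\<^sub>+]\<close>, where the primitives of two
  functions that agree there differ by a constant; constants are invisible to second derivatives of test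
  functions. So a profile for one function is a profile for the other, and uniqueness concludes.
\<close>

section \<open>Absolutely continuous primitives\<close>

text \<open>
  \<open>F\<close> is absolutely continuous on the compact subintervals of \<open>I\<close> with \<open>F' = f\<close> almost everywhere. Stating
  this by integrals avoids the almost everywhere differentiability of absolutely continuous functions, and
  makes the notion insensitive to changes of \<open>f\<close> on null sets.
\<close>

definition ac_primitive :: "real set \<Rightarrow> (real \<Rightarrow> real) \<Rightarrow> (real \<Rightarrow> real) \<Rightarrow> bool" where
  "ac_primitive I F f \<longleftrightarrow> (\<forall>a b. a \<le> b \<and> {a..b} \<subseteq> I \<longrightarrow>
     set_integrable lebesgue {a..b} f \<and> F b - F a = (LINT s:{a..b}|lebesgue. f s))"

lemma ac_primitiveI:
  assumes "\<And>a b. a \<le> b \<Longrightarrow> {a..b} \<subseteq> I \<Longrightarrow> set_integrable lebesgue {a..b} f"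
    and "\<And>a b. a \<le> b \<Longrightarrow> {a..b} \<subseteq> I \<Longrightarrow> F b - F a = (LINT s:{a..b}|lebesgue. f s)"
  shows "ac_primitive I F f"
  using assms unfolding ac_primitive_def by auto

lemma
  assumes "ac_primitive I F f" "a \<le> b" "{a..b} \<subseteq> I"
  shows ac_primitive_integrable: "set_integrable lebesgue {a..b} f"
    and ac_primitive_integral: "(LINT s:{a..b}|lebesgue. f s) = F b - F a"
  using assms unfolding ac_primitive_def by auto

lemma ac_primitive_subset: "ac_primitive I F f \<Longrightarrow> J \<subseteq> I \<Longrightarrow> ac_primitive J F f"
  unfolding ac_primitive_def by auto

lemma ac_primitive_add:
  "ac_primitive I F f \<Longrightarrow> ac_primitive I G g \<Longrightarrow> ac_primitive I (\<lambda>x. F x + G x) (\<lambda>x. f x + g x)"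
  by (rule ac_primitiveI)
    (simp_all add: set_integral_add ac_primitive_integrable ac_primitive_integral)

lemma ac_primitive_diff:
  "ac_primitive I F f \<Longrightarrow> ac_primitive I G g \<Longrightarrow> ac_primitive I (\<lambda>x. F x - G x) (\<lambda>x. f x - g x)"
  by (rule ac_primitiveI)
    (simp_all add: set_integral_diff ac_primitive_integrable ac_primitive_integral)

lemma ac_primitive_cmult: "ac_primitive I F f \<Longrightarrow> ac_primitive I (\<lambda>x. c * F x) (\<lambda>x. c * f x)"
  unfolding ac_primitive_def by (auto simp: algebra_simps)

lemma ac_primitive_add_const: "ac_primitive I F f \<Longrightarrow> ac_primitive I (\<lambda>x. F x + c) f"
  unfolding ac_primitive_def by auto

lemma ac_primitive_uminus: "ac_primitive I F f \<Longrightarrow> ac_primitive I (\<lambda>x. - F x) (\<lambda>x. - f x)"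
  using ac_primitive_cmult[of I F f "-1"] by simp

lemma ac_primitive_mono_AE:
  assumes "ac_primitive I F f" "ac_primitive I G g" "a \<le> b" "{a..b} \<subseteq> I"
    and "AE x in lebesgue. x \<in> {a..b} \<longrightarrow> f x \<le> g x"
  shows "F b - F a \<le> G b - G a"
proof -
  have "(LINT s:{a..b}|lebesgue. f s) \<le> (LINT s:{a..b}|lebesgue. g s)"
    using assms by (intro set_integral_mono_AE) (auto dest: ac_primitive_integrable)
  then show ?thesis using assms by (simp add: ac_primitive_integral)
qed

lemma set_integrable_lebesgue_cong_AE:
  fixes f g :: "real \<Rightarrow> real"
  assumes "set_integrable lebesgue A f" "AE x in lebesgue. x \<in> A \<longrightarrow> f x = g x"
  shows "set_integrable lebesgue A g"
    and "(LINT s:A|lebesgue. f s) = (LINT s:A|lebesgue. g s)"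
proof -
  have eq: "AE x in lebesgue. indicat_real A x *\<^sub>R f x = indicat_real A x *\<^sub>R g x"
    using assms(2) by eventually_elim (auto simp: indicator_def)
  have m: "(\<lambda>x. indicat_real A x *\<^sub>R f x) \<in> borel_measurable lebesgue"
    using assms(1) by (auto simp: set_integrable_def)
  have m': "(\<lambda>x. indicat_real A x *\<^sub>R g x) \<in> borel_measurable lebesgue"
    by (rule borel_measurable_AE[OF m eq])
  show "set_integrable lebesgue A g"
    using assms(1) m m' eq unfolding set_integrable_def by (subst integrable_cong_AE[symmetric]) auto
  show "(LINT s:A|lebesgue. f s) = (LINT s:A|lebesgue. g s)"
    unfolding set_lebesgue_integral_def by (rule integral_cong_AE[OF m m' eq])
qed

lemma ac_primitive_cong_AE:
  assumes "ac_primitive I F f" "AE x in lebesgue. x \<in> I \<longrightarrow> f x = g x"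
  shows "ac_primitive I F g"
proof (rule ac_primitiveI)
  fix a b :: real assume ab: "a \<le> b" "{a..b} \<subseteq> I"
  have ae: "AE x in lebesgue. x \<in> {a..b} \<longrightarrow> f x = g x"
    using assms(2) by eventually_elim (use ab in auto)
  note * = set_integrable_lebesgue_cong_AE[OF ac_primitive_integrable[OF assms(1) ab] ae]
  show "set_integrable lebesgue {a..b} g" by (fact *(1))
  show "F b - F a = (LINT s:{a..b}|lebesgue. g s)"
    using *(2) ac_primitive_integral[OF assms(1) ab] by simp
qed

lemma ac_primitive_has_integral:
  assumes "ac_primitive I F f" "a \<le> b" "{a..b} \<subseteq> I"
  shows "(f has_integral (F b - F a)) {a..b}"
  using has_integral_set_lebesgue[OF ac_primitive_integrable[OF assms]]
    ac_primitive_integral[OF assms] by simp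

lemma ac_primitive_continuous_on:
  assumes "ac_primitive I F f" and that: "{a..b} \<subseteq> I"
  shows "continuous_on {a..b} F"
proof (cases "a \<le> b")
  case True
  have "continuous_on {a..b} (\<lambda>x. F a + integral {a..x} f)"
    using ac_primitive_has_integral[OF assms(1) True that]
    by (intro continuous_intros indefinite_integral_continuous_1) auto
  then show ?thesis
  proof (rule continuous_on_eq)
    fix x assume "x \<in> {a..b}"
    then have "(f has_integral (F x - F a)) {a..x}"
      using that by (intro ac_primitive_has_integral[OF assms(1)]) auto
    then show "F a + integral {a..x} f = F x" by (simp add: integral_unique)
  qed
qed auto

lemma ac_primitive_isCont: "ac_primitive UNIV F f \<Longrightarrow> isCont F x"
  using ac_primitive_continuous_on[of UNIV F f "x - 1" "x + 1"]
    continuous_on_interior[of "{x-1..x+1}" F x] by auto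

lemma ac_primitive_continuous: "ac_primitive UNIV F f \<Longrightarrow> continuous_on S F"
  by (simp add: ac_primitive_isCont continuous_at_imp_continuous_on)

lemma ac_primitive_deriv_within:
  assumes "ac_primitive I F f" "{a..b} \<subseteq> I" "continuous_on {a..b} f" "x \<in> {a..b}"
  shows "(F has_real_derivative f x) (at x within {a..b})"
proof -
  have "((\<lambda>y. F a + integral {a..y} f) has_real_derivative f x) (at x within {a..b})"
    using integral_has_real_derivative[OF assms(3,4)] by (auto intro!: derivative_eq_intros)
  then show ?thesis
  proof (rule has_field_derivative_transform_within[OF _ zero_less_one assms(4)])
    fix y assume "y \<in> {a..b}"
    then have "(f has_integral (F y - F a)) {a..y}"
      using assms by (intro ac_primitive_has_integral[OF assms(1)]) auto
    then show "F a + integral {a..y} f = F y" by (simp add: integral_unique)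
  qed
qed

lemma ac_primitive_deriv:
  assumes "ac_primitive UNIV F f" "continuous_on UNIV f"
  shows "(F has_real_derivative f x) (at x)"
proof -
  have "(F has_real_derivative f x) (at x within {x-1..x+1})"
    using assms by (intro ac_primitive_deriv_within[of UNIV]) (auto intro: continuous_on_subset)
  then have "(F has_real_derivative f x) (at x within {x-1<..<x+1})"
    by (rule DERIV_subset) auto
  then show ?thesis by (subst (asm) at_within_open) auto
qed

lemma ac_primitive_C1:
  assumes "\<And>x. x \<in> I \<Longrightarrow> (F has_real_derivative f x) (at x)" "continuous_on I f"
  shows "ac_primitive I F f"
proof (rule ac_primitiveI)
  fix a b :: real assume ab: "a \<le> b" "{a..b} \<subseteq> I"
  have c: "continuous_on {a..b} f" using assms(2) ab(2) by (rule continuous_on_subset)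
  show i: "set_integrable lebesgue {a..b} f"
    using absolutely_integrable_continuous_real[OF c] .
  have "(f has_integral (F b - F a)) {a..b}"
  proof (rule fundamental_theorem_of_calculus[OF ab(1)])
    fix x assume "x \<in> {a..b}"
    then have "(F has_real_derivative f x) (at x within {a..b})"
      using ab assms(1) by (blast intro: has_field_derivative_at_within)
    then show "(F has_vector_derivative f x) (at x within {a..b})"
      by (simp add: has_real_derivative_iff_has_vector_derivative)
  qed
  then show "F b - F a = (LINT s:{a..b}|lebesgue. f s)"
    using has_integral_set_lebesgue[OF i] has_integral_unique by blast
qed

definition locally_integrable :: "(real \<Rightarrow> real) \<Rightarrow> bool" where
  "locally_integrable f \<longleftrightarrow> (\<forall>a b. set_integrable lebesgue {a..b} f)"

lemma LINT_Icc_combine: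
  fixes f :: "real \<Rightarrow> real"
  assumes "set_integrable lebesgue {a..c} f" "a \<le> b" "b \<le> c"
  shows "(LINT s:{a..c}|lebesgue. f s) = (LINT s:{a..b}|lebesgue. f s) + (LINT s:{b..c}|lebesgue. f s)"
proof -
  have "set_integrable lebesgue {a..b} f" "set_integrable lebesgue {b..c} f"
    using assms by (auto intro: set_integrable_subset[OF assms(1)])
  then show ?thesis
    using set_lebesgue_integral_eq_integral assms Henstock_Kurzweil_Integration.integral_combine[of a b c f]
    by (metis )
qed

lemma ac_primitive_exists:
  assumes "locally_integrable f"
  obtains F where "ac_primitive UNIV F f" "F p = 0"
proof -
  define F where "F x = (if p \<le> x then (LINT s:{p..x}|lebesgue. f s) else - (LINT s:{x..p}|lebesgue. f s))" for x
  have i: "set_integrable lebesgue {a..b} f" for a b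
    using assms by (auto simp: locally_integrable_def)
  have pp: "(LINT s:{p}|lebesgue. f s) = 0"
    using set_lebesgue_integral_eq_integral(2)[OF i[of p p]] by simp
  have 0: "F p = 0" by (simp add: F_def pp)
  have "ac_primitive UNIV F f"
  proof (rule ac_primitiveI[OF i])
    fix a b :: real assume ab: "a \<le> b"
    consider "p \<le> a" | "a < p" "p \<le> b" | "b < p" by linarith
    then show "F b - F a = (LINT s:{a..b}|lebesgue. f s)"
    proof cases
      case 1 then show ?thesis using ab LINT_Icc_combine[OF i[of p b], of a] by (simp add: F_def)
    next
      case 2 then show ?thesis using ab LINT_Icc_combine[OF i[of a b], of p] by (simp add: F_def)
    next
      case 3 then show ?thesis using ab LINT_Icc_combine[OF i[of a p], of b] by (simp add: F_def)
    qed
  qed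
  then show ?thesis using 0 by (rule that)
qed

lemma sigma_finite_lebesgue: "sigma_finite_measure (lebesgue :: real measure)"
proof
  let ?A = "range (\<lambda>n::nat. {- real n..real n})"
  have "\<exists>n::nat. - real n \<le> x \<and> x \<le> real n" for x :: real
  proof -
    obtain n :: nat where "\<bar>x\<bar> \<le> real n" using real_arch_simple by blast
    then show ?thesis by (intro exI[of _ n]) auto
  qed
  then have "\<Union>?A = space lebesgue" by auto
  then show "\<exists>A. countable A \<and> A \<subseteq> sets lebesgue \<and> \<Union>A = space (lebesgue :: real measure) \<and>
      (\<forall>a\<in>A. emeasure lebesgue a \<noteq> \<infinity>)"
    by (intro exI[of _ ?A]) (auto simp: )
qed

text \<open>
  Fubini's theorem on the square \<open>[a, b]\<^sup>2\<close>: the two summands of \<open>f (G - G a) + (F - F a) g\<close> integrate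
  \<open>f(x) g(y)\<close> over the two triangles below and above the diagonal.
\<close>

lemma ac_primitive_mult:
  assumes F: "ac_primitive I F f" and G: "ac_primitive I G g"
  shows "ac_primitive I (\<lambda>x. F x * G x) (\<lambda>x. f x * G x + F x * g x)"
proof -
  interpret L: sigma_finite_measure "lebesgue :: real measure" by (rule sigma_finite_lebesgue)
  interpret P: pair_sigma_finite "lebesgue :: real measure" "lebesgue :: real measure" ..
  have main: "set_integrable lebesgue {a..b} (\<lambda>x. f x * (G x - G a)) \<and>
     set_integrable lebesgue {a..b} (\<lambda>x. (F x - F a) * g x) \<and>
     (LINT x:{a..b}|lebesgue. f x * (G x - G a)) + (LINT x:{a..b}|lebesgue. (F x - F a) * g x)
        = (F b - F a) * (G b - G a)" if ab: "a \<le> b" "{a..b} \<subseteq> I" for a b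
  proof -
    define f' where "f' x = indicat_real {a..b} x * f x" for x
    define g' where "g' x = indicat_real {a..b} x * g x" for x
    have if': "integrable lebesgue f'" and ig': "integrable lebesgue g'"
      using ac_primitive_integrable[OF F ab] ac_primitive_integrable[OF G ab]
      unfolding f'_def g'_def set_integrable_def by auto
    have Fx: "(LINT s|lebesgue. indicat_real {..x} s * f' s) = F x - F a" if "x \<in> {a..b}" for x
    proof -
      have "(LINT s|lebesgue. indicat_real {..x} s * f' s) = (LINT s:{a..x}|lebesgue. f s)"
        unfolding set_lebesgue_integral_def f'_def
        by (rule Bochner_Integration.integral_cong) (use that in \<open>auto simp: indicator_def\<close>)
      moreover have "{a..x} \<subseteq> I" "a \<le> x" using that ab by auto
      ultimately show ?thesis using ac_primitive_integral[OF F, of a x] by simp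
    qed
    have Gx: "(LINT s|lebesgue. indicat_real {..<x} s * g' s) = G x - G a" if "x \<in> {a..b}" for x
    proof -
      have "AE s in lebesgue. s \<noteq> x" by (intro AE_completion AE_lborel_singleton)
      then have "(LINT s|lebesgue. indicat_real {..<x} s * g' s) = (LINT s|lebesgue. indicat_real {..x} s * g' s)"
      proof (intro integral_cong_AE)
        show "(\<lambda>s. indicat_real {..<x} s * g' s) \<in> borel_measurable lebesgue"
          "(\<lambda>s. indicat_real {..x} s * g' s) \<in> borel_measurable lebesgue"
          using ig' by - (rule borel_measurable_times[OF borel_measurable_indicator]; simp)+
      qed (auto simp: indicator_def elim!: eventually_mono)
      also have "\<dots> = (LINT s:{a..x}|lebesgue. g s)"
        unfolding set_lebesgue_integral_def g'_def
        by (rule Bochner_Integration.integral_cong) (use that in \<open>auto simp: indicator_def\<close>)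
      finally show ?thesis
        using ac_primitive_integral[OF G, of a x] that ab subset_trans[of "{a..x}" "{a..b}" I] by auto
    qed
    have [measurable]: "f' \<in> borel_measurable lebesgue" "g' \<in> borel_measurable lebesgue"
      using if' ig' by auto
    have id: "(\<lambda>x::real. x) \<in> borel_measurable lebesgue"
      using id_borel_measurable_lebesgue by (simp add: id_def)
    note fst_m = measurable_compose[OF measurable_fst id] and snd_m = measurable_compose[OF measurable_snd id]
    have prod: "integrable (lebesgue \<Otimes>\<^sub>M lebesgue) (\<lambda>(x,y). f' x * g' y)"
      by (rule P.Fubini_integrable) (use if' ig' in \<open>auto simp: abs_mult\<close>)
    have S: "{p. snd p < fst p} \<in> sets ((lebesgue::real measure) \<Otimes>\<^sub>M (lebesgue::real measure))"
      using measurable_sets[OF borel_measurable_diff[OF fst_m snd_m], of "{0<..}"]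
      by (simp add: vimage_def space_pair_measure)
    define K where "K = (\<lambda>(x,y). indicat_real {..<x} y * (f' x * g' y))"
    define K' where "K' = (\<lambda>(x,y). indicat_real {..y} x * (f' x * g' y))"
    have K: "integrable (lebesgue \<Otimes>\<^sub>M lebesgue) K"
    proof -
      have "K = (\<lambda>p. indicat_real {p. snd p < fst p} p *\<^sub>R (\<lambda>(x,y). f' x * g' y) p)"
        by (auto simp: K_def indicator_def fun_eq_iff)
      then show ?thesis using integrable_mult_indicator[OF S prod] by simp
    qed
    have K': "integrable (lebesgue \<Otimes>\<^sub>M lebesgue) K'"
    proof -
      have "K' = (\<lambda>p. (\<lambda>(x,y). f' x * g' y) p - K p)"
        by (auto simp: K'_def K_def indicator_def fun_eq_iff)
      then show ?thesis using prod K by simp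
    qed
    have sum: "K p + K' p = (\<lambda>(x,y). f' x * g' y) p" for p
      by (auto simp: K'_def K_def indicator_def split: prod.splits)
    have 1: "(LINT y|lebesgue. K (x, y)) = indicat_real {a..b} x *\<^sub>R (f x * (G x - G a))" for x
      using Gx[of x] by (auto simp: K_def f'_def indicator_def mult.left_commute[of _ "f x"])
    have 2: "(LINT x|lebesgue. K' (x, y)) = indicat_real {a..b} y *\<^sub>R ((F y - F a) * g y)" for y
      using Fx[of y] by (auto simp: K'_def g'_def indicator_def mult.assoc[symmetric])
    have "set_integrable lebesgue {a..b} (\<lambda>x. f x * (G x - G a))"
      using P.integrable_fst'[OF K] unfolding set_integrable_def 1 .
    moreover have "set_integrable lebesgue {a..b} (\<lambda>x. (F x - F a) * g x)"
      using P.integrable_snd[of "\<lambda>x y. K' (x,y)"] K' unfolding set_integrable_def 2 by simp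
    moreover have "(LINT x:{a..b}|lebesgue. f x * (G x - G a)) = integral\<^sup>L (lebesgue \<Otimes>\<^sub>M lebesgue) K"
      using P.integral_fst'[OF K] unfolding set_lebesgue_integral_def 1 .
    moreover have "(LINT x:{a..b}|lebesgue. (F x - F a) * g x) = integral\<^sup>L (lebesgue \<Otimes>\<^sub>M lebesgue) K'"
      using P.integral_snd[of "\<lambda>x y. K' (x,y)"] K' unfolding set_lebesgue_integral_def 2 by simp
    moreover have "integral\<^sup>L (lebesgue \<Otimes>\<^sub>M lebesgue) K + integral\<^sup>L (lebesgue \<Otimes>\<^sub>M lebesgue) K'
        = integral\<^sup>L (lebesgue \<Otimes>\<^sub>M lebesgue) (\<lambda>(x,y). f' x * g' y)"
      using K K' by (subst Bochner_Integration.integral_add[symmetric]) (auto simp: sum)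
    moreover have "\<dots> = (LINT x|lebesgue. f' x) * (LINT x|lebesgue. g' x)"
      using P.integral_fst'[OF prod] by simp
    moreover have "(LINT x|lebesgue. f' x) = F b - F a" "(LINT x|lebesgue. g' x) = G b - G a"
      using ac_primitive_integral[OF F ab] ac_primitive_integral[OF G ab]
      by (auto simp: f'_def g'_def set_lebesgue_integral_def)
    ultimately show ?thesis by simp
  qed
  show ?thesis
  proof (rule ac_primitiveI)
    fix a b :: real assume ab: "a \<le> b" "{a..b} \<subseteq> I"
    note m = main[OF ab]
    have i: "set_integrable lebesgue {a..b} f" "set_integrable lebesgue {a..b} g"
      using ac_primitive_integrable[OF F ab] ac_primitive_integrable[OF G ab] by auto
    have eq: "(\<lambda>x. f x * G x + F x * g x) =
        (\<lambda>x. (f x * (G x - G a) + (F x - F a) * g x) + (G a * f x + F a * g x))"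
      by (auto simp: algebra_simps fun_eq_iff)
    show "set_integrable lebesgue {a..b} (\<lambda>x. f x * G x + F x * g x)"
      unfolding eq using m i by (intro set_integral_add) auto
    have "(LINT s:{a..b}|lebesgue. f s * G s + F s * g s) =
       (F b - F a) * (G b - G a) + (G a * (F b - F a) + F a * (G b - G a))"
      unfolding eq using m i ac_primitive_integral[OF F ab] ac_primitive_integral[OF G ab]
      by (simp add: set_integral_add)
    then show "F b * G b - F a * G a = (LINT s:{a..b}|lebesgue. f s * G s + F s * g s)"
      by (simp add: algebra_simps)
  qed
qed

text \<open>
  The sets over which the integral of \<open>h\<close> vanishes form a Dynkin system, and the closed intervals are a
  generator of the Borel sets that is stable under intersection; so \<open>h\<close> integrates to zero over every Borel
  set.
\<close>

lemma AE_zero_if_zero_integrals: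
  fixes h :: "real \<Rightarrow> real"
  assumes i: "set_integrable lebesgue {a..b} h"
    and z: "\<And>c d. a \<le> c \<Longrightarrow> c \<le> d \<Longrightarrow> d \<le> b \<Longrightarrow> (LINT s:{c..d}|lebesgue. h s) = 0"
  shows "AE x in lebesgue. x \<in> {a..b} \<longrightarrow> h x = 0"
proof -
  have "(\<lambda>x. indicat_real {a..b} x * h x) \<in> borel_measurable (completion lborel)"
    using i by (auto simp: set_integrable_def)
  from completion_ex_borel_measurable_real[OF this] obtain k
    where k[measurable]: "k \<in> borel_measurable lborel"
      and eq: "AE x in lborel. indicat_real {a..b} x * h x = k x" by auto
  have eq': "AE x in lebesgue. indicat_real {a..b} x * h x = k x" using eq by (rule AE_completion)
  have k': "k \<in> borel_measurable lebesgue" using k by (rule measurable_completion)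
  have ik': "integrable lebesgue k"
    using i eq' k' unfolding set_integrable_def
    by (subst integrable_cong_AE[symmetric, OF _ _ eq']) auto
  then have ik: "integrable lborel k" using k by (simp add: integrable_completion)
  have box: "(LINT x:{c..d}|lborel. k x) = 0" for c d
  proof -
    have "(LINT x:{c..d}|lborel. k x) = (LINT x:{c..d}|lebesgue. k x)"
      unfolding set_lebesgue_integral_def by (subst integral_completion) auto
    also have "\<dots> = (LINT x|lebesgue. indicat_real {c..d} x * (indicat_real {a..b} x * h x))"
    proof -
      have "(\<lambda>x. indicat_real {c..d} x * k x) \<in> borel_measurable lebesgue"
        by (rule borel_measurable_times[OF borel_measurable_indicator k']) simp
      moreover have "(\<lambda>x. indicat_real {c..d} x * (indicat_real {a..b} x * h x)) \<in> borel_measurable lebesgue"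
        using i by - (rule borel_measurable_times[OF borel_measurable_indicator];
          simp add: set_integrable_def borel_measurable_integrable)
      ultimately show ?thesis unfolding set_lebesgue_integral_def real_scaleR_def
        by (rule integral_cong_AE) (use eq' in \<open>auto elim!: eventually_mono\<close>)
    qed
    also have "\<dots> = (LINT x:{max a c..min b d}|lebesgue. h x)"
      unfolding set_lebesgue_integral_def
      by (rule Bochner_Integration.integral_cong) (auto simp: indicator_def)
    also have "\<dots> = 0"
    proof (cases "max a c \<le> min b d")
      case True then show ?thesis by (intro z) auto
    qed (simp add: set_lebesgue_integral_def)
    finally show ?thesis .
  qed
  have univ: "(LINT x:UNIV|lborel. k x) = 0"
  proof -
    have "(LINT x:UNIV|lborel. k x) = (LINT x|lebesgue. k x)"
      unfolding set_lebesgue_integral_def by (simp add: integral_completion)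
    also have "\<dots> = (LINT x:{a..b}|lebesgue. h x)"
      unfolding set_lebesgue_integral_def
      using k' eq' i unfolding set_integrable_def
      by (intro integral_cong_AE) (auto elim!: eventually_mono)
    also have "\<dots> = 0"
    proof (cases "a \<le> b")
      case True then show ?thesis by (intro z) auto
    qed (simp add: set_lebesgue_integral_def)
    finally show ?thesis .
  qed
  have gen: "sets (lborel::real measure) = sigma_sets UNIV (range (\<lambda>(c,d). {c..d::real}))"
    unfolding sets_lborel borel_eq_atLeastAtMost by (rule sets_measure_of) simp
  have set_i: "set_integrable lborel A k" if "A \<in> sets lborel" for A
    unfolding set_integrable_def by (rule integrable_mult_indicator[OF that ik])
  have "AE x in lborel. k x = 0"
  proof (rule sigma_finite_measure.density_zero[OF sigma_finite_lborel ik])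
    fix A :: "real set" assume A: "A \<in> sets lborel"
    have "{c..d} \<inter> {c'..d'} \<in> range (\<lambda>(c,d). {c..d})" for c d c' d' :: real
      by (rule range_eqI[of _ _ "(max c c', min d d')"]) simp
    then have "Int_stable (range (\<lambda>(c,d). {c..d::real}))"
      unfolding Int_stable_def by (safe; simp only:)
    moreover have "range (\<lambda>(c,d). {c..d::real}) \<subseteq> Pow UNIV" by auto
    moreover have "A \<in> sigma_sets UNIV (range (\<lambda>(c,d). {c..d::real}))" using A gen by simp
    ultimately show "(LINT x:A|lborel. k x) = 0"
    proof (induction rule: sigma_sets_induct_disjoint)
      case (basic A) then show ?case using box by auto
    next
      case empty then show ?case by (simp add: set_lebesgue_integral_def)
    next
      case (compl A)
      then have A: "A \<in> sets lborel" "UNIV - A \<in> sets lborel"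
        unfolding gen using compl(1) by (auto intro: sigma_sets.Compl)
      have "(LINT x:A \<union> (UNIV - A)|lborel. k x) = (LINT x:A|lborel. k x) + (LINT x:UNIV-A|lborel. k x)"
        using A by (intro set_integral_Un set_i) auto
      then show ?case using univ compl by simp
    next
      case (union A)
      then have A: "A i \<in> sets lborel" for i unfolding gen by auto
      have "(LINT x:(\<Union>i. A i)|lborel. k x) = (\<Sum>i. (LINT x:(A i)|lborel. k x))"
        using A union(1)
        by (intro lebesgue_integral_countable_add set_i sets.countable_UN') (auto simp: disjoint_family_on_def)
      then show ?case using union by simp
    qed
  qed
  then have "AE x in lebesgue. k x = 0" by (rule AE_completion)
  with eq' show ?thesis by eventually_elim (auto simp: indicator_def)
qed

section \<open>Test functions and the du Bois-Reymond lemmas\<close>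

lemma AE_lebesgue_ex:
  fixes a b :: real
  assumes "AE x in lebesgue. P x" "a < b"
  shows "\<exists>x. a < x \<and> x < b \<and> P x"
proof (rule ccontr)
  assume *: "\<not> ?thesis"
  have "AE x in lebesgue. x \<notin> {a<..<b}"
    using assms(1) by eventually_elim (use * in auto)
  then have "{a<..<b} \<in> null_sets lebesgue"
    by (subst (asm) AE_iff_null_sets[symmetric]) auto
  then show False using \<open>a < b\<close> by (auto simp: null_sets_def)
qed

lemma AE_if_AE_on_Icc:
  assumes "\<And>n. AE x in lebesgue. x \<in> {- real n..real n} \<longrightarrow> P x"
  shows "AE x in lebesgue. P x"
proof -
  have "AE x in lebesgue. \<forall>n. x \<in> {- real n..real n} \<longrightarrow> P x"
    using assms by (subst AE_all_countable) blast
  then show ?thesis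
  proof eventually_elim
    case (elim x)
    obtain n :: nat where "\<bar>x\<bar> \<le> real n" using real_arch_simple by blast
    then have "x \<in> {- real n..real n}" by auto
    then show ?case using elim by blast
  qed
qed

lemma Cc_0: "\<phi> \<in> Cc 0 \<longleftrightarrow> continuous_on UNIV \<phi> \<and> compact (closure {x. \<phi> x \<noteq> 0})"
  by (simp add: Cc_def)

lemma Cc_support:
  assumes "\<phi> \<in> Cc k"
  obtains R where "R > 0" "\<And>x. R \<le> \<bar>x\<bar> \<Longrightarrow> \<phi> x = 0"
proof -
  have "bounded {x. \<phi> x \<noteq> 0}"
    using assms compact_imp_bounded bounded_subset closure_subset unfolding Cc_def by blast
  then obtain B where B: "B > 0" "\<And>x. \<phi> x \<noteq> 0 \<Longrightarrow> \<bar>x\<bar> \<le> B"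
    by (auto simp: bounded_pos)
  show ?thesis by (rule that[of "B + 1"]) (use B in force)+
qed

lemma compact_supportI:
  fixes \<phi> :: "real \<Rightarrow> real"
  assumes "\<And>x. R \<le> \<bar>x\<bar> \<Longrightarrow> \<phi> x = 0"
  shows "compact (closure {x. \<phi> x \<noteq> 0})"
proof -
  have "{x. \<phi> x \<noteq> 0} \<subseteq> {-R..R}" using assms by force
  then show ?thesis by (meson bounded_closed_interval bounded_subset compact_closure)
qed

lemma Cc_SucI:
  assumes "\<And>x. (\<Phi> has_real_derivative \<phi> x) (at x)" "\<phi> \<in> Cc k" "\<And>x. R \<le> \<bar>x\<bar> \<Longrightarrow> \<Phi> x = 0"
  shows "\<Phi> \<in> Cc (Suc k)"
proof -
  have d: "deriv \<Phi> = \<phi>" using assms(1) DERIV_imp_deriv by blast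
  have s: "(deriv ^^ Suc j) \<Phi> = (deriv ^^ j) \<phi>" for j
    by (simp add: funpow_swap1 d)
  have "(deriv ^^ j) \<Phi> differentiable_on UNIV" if "j < Suc k" for j
  proof (cases j)
    case 0 then show ?thesis using assms(1)
      by (auto simp: differentiable_on_def intro!: differentiableI has_field_derivative_imp_has_derivative)
  next
    case (Suc i) then show ?thesis using assms(2) that by (auto simp del: funpow.simps simp: s Cc_def)
  qed
  moreover have "continuous_on UNIV ((deriv ^^ Suc k) \<Phi>)"
    unfolding s using assms(2) by (simp add: Cc_def)
  moreover have "compact (closure {x. \<Phi> x \<noteq> 0})" by (rule compact_supportI[OF assms(3)])
  ultimately show ?thesis unfolding Cc_def by blast
qed

lemma
  assumes "\<phi> \<in> Cc (Suc k)"
  shows Cc_Suc_deriv: "(\<phi> has_real_derivative deriv \<phi> x) (at x)"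
    and Cc_deriv: "deriv \<phi> \<in> Cc k"
proof -
  have s: "(deriv ^^ Suc j) \<phi> = (deriv ^^ j) (deriv \<phi>)" for j
    by (simp add: funpow_swap1)
  have "(deriv ^^ 0) \<phi> differentiable_on UNIV" using assms unfolding Cc_def by blast
  then have D: "(\<phi> has_real_derivative deriv \<phi> x) (at x)" for x
    by (auto simp: differentiable_on_def DERIV_deriv_iff_real_differentiable)
  then show "(\<phi> has_real_derivative deriv \<phi> x) (at x)" .
  obtain R where R: "\<And>x. R \<le> \<bar>x\<bar> \<Longrightarrow> \<phi> x = 0" using Cc_support[OF assms] by metis
  have "deriv \<phi> x = 0" if "R + 1 \<le> \<bar>x\<bar>" for x
  proof -
    have "((\<lambda>x. 0) has_real_derivative deriv \<phi> x) (at x)"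
      by (rule has_field_derivative_transform_within[OF D zero_less_one])
        (use that R in \<open>auto simp: dist_real_def\<close>)
    then show ?thesis using DERIV_unique DERIV_const by blast
  qed
  then have "compact (closure {x. deriv \<phi> x \<noteq> 0})" by (rule compact_supportI)
  then show "deriv \<phi> \<in> Cc k"
    using assms unfolding Cc_def s[symmetric] mem_Collect_eq by auto
qed

lemma Cc_continuous: "\<phi> \<in> Cc k \<Longrightarrow> continuous_on UNIV \<phi>"
proof (cases k)
  case 0 then show "\<phi> \<in> Cc k \<Longrightarrow> ?thesis" by (simp add: Cc_0)
next
  case (Suc j) then show "\<phi> \<in> Cc k \<Longrightarrow> ?thesis"
    using Cc_Suc_deriv DERIV_isCont by (metis continuous_at_imp_continuous_on)
qed

lemma Cc_Suc_subset: "Cc (Suc k) \<subseteq> Cc k"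
proof (induction k)
  case 0
  have "\<phi> \<in> Cc 0" if "\<phi> \<in> Cc (Suc 0)" for \<phi>
    using Cc_continuous[OF that] that unfolding Cc_0 by (simp add: Cc_def)
  then show ?case by blast
next
  case (Suc k)
  show ?case
  proof
    fix \<phi> assume \<phi>: "\<phi> \<in> Cc (Suc (Suc k))"
    obtain R where R: "\<And>x. R \<le> \<bar>x\<bar> \<Longrightarrow> \<phi> x = 0" using Cc_support[OF \<phi>] by metis
    show "\<phi> \<in> Cc (Suc k)"
      using Cc_SucI[OF Cc_Suc_deriv[OF \<phi>] _ R] Cc_deriv[OF \<phi>] Suc by blast
  qed
qed

lemma Cc_lincomb:
  "\<phi> \<in> Cc k \<Longrightarrow> \<theta> \<in> Cc k \<Longrightarrow> (\<lambda>x. \<phi> x - c * \<theta> x) \<in> Cc k"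
proof (induction k arbitrary: \<phi> \<theta>)
  case 0
  obtain R where R: "\<And>x. R \<le> \<bar>x\<bar> \<Longrightarrow> \<phi> x = 0" using Cc_support[OF 0(1)] by metis
  obtain S where S: "\<And>x. S \<le> \<bar>x\<bar> \<Longrightarrow> \<theta> x = 0" using Cc_support[OF 0(2)] by metis
  have "compact (closure {x. \<phi> x - c * \<theta> x \<noteq> 0})"
    by (rule compact_supportI[of "max R S"]) (use R S in auto)
  then show ?case using 0 by (auto simp: Cc_0 intro!: continuous_intros)
next
  case (Suc k)
  obtain R where R: "\<And>x. R \<le> \<bar>x\<bar> \<Longrightarrow> \<phi> x = 0" using Cc_support[OF Suc(2)] by metis
  obtain S where S: "\<And>x. S \<le> \<bar>x\<bar> \<Longrightarrow> \<theta> x = 0" using Cc_support[OF Suc(3)] by metis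
  show ?case
  proof (rule Cc_SucI)
    show "((\<lambda>x. \<phi> x - c * \<theta> x) has_real_derivative deriv \<phi> x - c * deriv \<theta> x) (at x)" for x
      by (auto intro!: derivative_eq_intros Cc_Suc_deriv[OF Suc(2)] Cc_Suc_deriv[OF Suc(3)])
    show "(\<lambda>x. deriv \<phi> x - c * deriv \<theta> x) \<in> Cc k"
      by (intro Suc.IH Cc_deriv Suc.prems)
    show "max R S \<le> \<bar>x\<bar> \<Longrightarrow> \<phi> x - c * \<theta> x = 0" for x using R S by auto
  qed
qed

lemma locally_integrable_continuous: "continuous_on UNIV f \<Longrightarrow> locally_integrable f"
  unfolding locally_integrable_def
  by (auto intro: absolutely_integrable_continuous_real continuous_on_subset)

lemma locally_integrable_mult_continuous:
  assumes h: "locally_integrable h" and c: "continuous_on UNIV \<phi>"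
  shows "locally_integrable (\<lambda>x. h x * \<phi> x)"
  unfolding locally_integrable_def
proof (intro allI)
  fix a b :: real
  have i: "set_integrable lebesgue {a..b} h" using h by (simp add: locally_integrable_def)
  have "compact (\<phi> ` {a..b})"
    by (intro compact_continuous_image continuous_on_subset[OF c]) auto
  then obtain B where B: "\<And>x. x \<in> {a..b} \<Longrightarrow> \<bar>\<phi> x\<bar> \<le> B"
    by (meson bounded_real compact_imp_bounded image_eqI)
  have m: "\<phi> \<in> borel_measurable lebesgue"
    by (intro measurable_completion) (simp add: borel_measurable_continuous_onI[OF c])
  show "set_integrable lebesgue {a..b} (\<lambda>x. h x * \<phi> x)"
  proof (rule set_integrable_bound)
    show "set_integrable lebesgue {a..b} (\<lambda>x. B * h x)" using i by simp
    have "(\<lambda>x. (indicat_real {a..b} x *\<^sub>R h x) * \<phi> x) \<in> borel_measurable lebesgue"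
      using i m by (intro borel_measurable_times) (auto simp: set_integrable_def)
    then show "set_borel_measurable lebesgue {a..b} (\<lambda>x. h x * \<phi> x)"
      unfolding set_borel_measurable_def by (simp add: mult.assoc)
    show "AE x in lebesgue. x \<in> {a..b} \<longrightarrow> norm (h x * \<phi> x) \<le> norm (B * h x)"
    proof (intro AE_I2 impI)
      fix x assume "x \<in> {a..b}"
      then have "\<bar>\<phi> x\<bar> \<le> \<bar>B\<bar>" using B[of x] by linarith
      then have "\<bar>h x\<bar> * \<bar>\<phi> x\<bar> \<le> \<bar>h x\<bar> * \<bar>B\<bar>" by (rule mult_left_mono) simp
      then show "norm (h x * \<phi> x) \<le> norm (B * h x)" by (simp add: abs_mult mult.commute)
    qed
  qed
qed

lemma integral_Icc_support:
  assumes "locally_integrable f" "\<And>x. x \<notin> {a..b} \<Longrightarrow> f x = 0"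
  shows "integrable lebesgue f" "(LINT x|lebesgue. f x) = (LINT x:{a..b}|lebesgue. f x)"
proof -
  have eq: "f = (\<lambda>x. indicat_real {a..b} x *\<^sub>R f x)" using assms(2) by (auto simp: indicator_def fun_eq_iff)
  show "integrable lebesgue f"
    using assms(1) unfolding locally_integrable_def set_integrable_def by (subst eq) blast
  show "(LINT x|lebesgue. f x) = (LINT x:{a..b}|lebesgue. f x)"
    unfolding set_lebesgue_integral_def by (subst eq) simp
qed

lemma integrable_test:
  assumes "locally_integrable h" "\<phi> \<in> Cc k"
  shows "integrable lebesgue (\<lambda>x. h x * \<phi> x)"
proof -
  obtain R where R: "\<And>x. R \<le> \<bar>x\<bar> \<Longrightarrow> \<phi> x = 0" using Cc_support[OF assms(2)] by metis
  show ?thesis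
    by (rule integral_Icc_support(1)[of _ "-R" R])
      (use assms Cc_continuous R in \<open>auto intro!: locally_integrable_mult_continuous\<close>)
qed

lemma integrable_test_only: "\<phi> \<in> Cc k \<Longrightarrow> integrable lebesgue \<phi>"
  using integrable_test[of "\<lambda>x. 1" \<phi> k] locally_integrable_continuous[of "\<lambda>x. 1"] by simp

lemma integral_compact_support_zero:
  assumes F: "ac_primitive UNIV F f" and R: "\<And>x. R \<le> \<bar>x\<bar> \<Longrightarrow> F x = 0 \<and> f x = 0" "R > 0"
  shows "(LINT x|lebesgue. f x) = 0"
proof -
  have "locally_integrable f"
    unfolding locally_integrable_def
  proof (intro allI)
    fix a b show "set_integrable lebesgue {a..b} f"
      by (cases "a \<le> b") (auto intro: ac_primitive_integrable[OF F])
  qed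
  then have "(LINT x|lebesgue. f x) = (LINT x:{-R..R}|lebesgue. f x)"
    by (rule integral_Icc_support) (use R in auto)
  also have "\<dots> = F R - F (-R)" using R by (intro ac_primitive_integral[OF F]) auto
  finally show ?thesis using R by simp
qed

lemma integral_by_parts_test:
  assumes F: "ac_primitive UNIV F f" and f: "locally_integrable f" and \<phi>: "\<phi> \<in> Cc (Suc k)"
  shows "(LINT x|lebesgue. F x * deriv \<phi> x) = - (LINT x|lebesgue. f x * \<phi> x)"
proof -
  obtain R where R: "R > 0" "\<And>x. R \<le> \<bar>x\<bar> \<Longrightarrow> \<phi> x = 0" using Cc_support[OF \<phi>] by metis
  obtain S where S: "S > 0" "\<And>x. S \<le> \<bar>x\<bar> \<Longrightarrow> deriv \<phi> x = 0" using Cc_support[OF Cc_deriv[OF \<phi>]] by metis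
  have "ac_primitive UNIV \<phi> (deriv \<phi>)"
    by (intro ac_primitive_C1 Cc_Suc_deriv[OF \<phi>] Cc_continuous[OF Cc_deriv[OF \<phi>]])
  from ac_primitive_mult[OF F this]
  have "(LINT x|lebesgue. f x * \<phi> x + F x * deriv \<phi> x) = 0"
    by (rule integral_compact_support_zero[of _ _ "max R S"]) (use R S in auto)
  moreover have "integrable lebesgue (\<lambda>x. F x * deriv \<phi> x)"
    by (rule integrable_test[OF locally_integrable_continuous[OF ac_primitive_continuous[OF F]] Cc_deriv[OF \<phi>]])
  ultimately show ?thesis using integrable_test[OF f \<phi>] by simp
qed

text \<open>
  The primitive vanishing on the far left also vanishes on the far right exactly because the integral of
  \<open>\<phi>\<close> is zero.
\<close>

lemma Cc_primitive:
  assumes \<phi>: "\<phi> \<in> Cc k" and zero: "(LINT x|lebesgue. \<phi> x) = 0"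
  obtains \<Phi> where "\<Phi> \<in> Cc (Suc k)" "deriv \<Phi> = \<phi>"
proof -
  obtain R where R: "R > 0" "\<And>x. R \<le> \<bar>x\<bar> \<Longrightarrow> \<phi> x = 0" using Cc_support[OF \<phi>] by metis
  have l: "locally_integrable \<phi>" by (rule locally_integrable_continuous[OF Cc_continuous[OF \<phi>]])
  obtain \<Phi> where \<Phi>: "ac_primitive UNIV \<Phi> \<phi>" "\<Phi> (-R) = 0" using ac_primitive_exists[OF l] .
  have D: "(\<Phi> has_real_derivative \<phi> x) (at x)" for x
    by (rule ac_primitive_deriv[OF \<Phi>(1) Cc_continuous[OF \<phi>]])
  have "\<Phi> R - \<Phi> (-R) = 0"
  proof -
    have "(LINT x|lebesgue. \<phi> x) = (LINT x:{-R..R}|lebesgue. \<phi> x)"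
      by (rule integral_Icc_support(2)[OF l]) (use R in force)
    then show ?thesis using R zero ac_primitive_integral[OF \<Phi>(1), of "-R" R] by simp
  qed
  then have PR: "\<Phi> R = 0" using \<Phi>(2) by simp
  have flat: "\<Phi> d - \<Phi> c = 0" if "c \<le> d" "\<And>x. x \<in> {c..d} \<Longrightarrow> \<phi> x = 0" for c d
  proof -
    have "\<Phi> d - \<Phi> c = (LINT s:{c..d}|lebesgue. \<phi> s)"
      using ac_primitive_integral[OF \<Phi>(1)] that by simp
    also have "\<dots> = (LINT s:{c..d}|lebesgue. 0)"
      using that by (intro set_lebesgue_integral_cong) auto
    finally show ?thesis by simp
  qed
  have "\<Phi> x = 0" if "R \<le> \<bar>x\<bar>" for x
  proof (cases "x \<ge> 0")
    case True then show ?thesis using flat[of R x] PR R that by auto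
  next
    case False then show ?thesis using flat[of x "-R"] \<Phi>(2) R that by auto
  qed
  then have "\<Phi> \<in> Cc (Suc k)" by (rule Cc_SucI[OF D \<phi>])
  moreover have "deriv \<Phi> = \<phi>" using D DERIV_imp_deriv by blast
  ultimately show ?thesis by (rule that)
qed

text \<open>
  This makes the square of the positive part of \<open>1 - x\<^sup>2\<close> a bump function of class \<open>C\<^sup>1\<close>.
\<close>

lemma has_derivative_max_0_square:
  "((\<lambda>t::real. (max 0 t)\<^sup>2) has_real_derivative 2 * max 0 t) (at t)"
proof -
  consider "t > 0" | "t < 0" | "t = 0" by linarith
  then show ?thesis
  proof cases
    case 1
    have "((\<lambda>t. t\<^sup>2) has_real_derivative 2 * t) (at t)" by (auto intro!: derivative_eq_intros)
    then have "((\<lambda>t. (max 0 t)\<^sup>2) has_real_derivative 2 * t) (at t)"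
      by (rule has_field_derivative_transform_within_open[of _ _ _ "{0<..}"]) (use 1 in auto)
    then show ?thesis using 1 by simp
  next
    case 2
    have "((\<lambda>t. 0) has_real_derivative 0) (at t)" by auto
    then have "((\<lambda>t. (max 0 t)\<^sup>2) has_real_derivative 0) (at t)"
      by (rule has_field_derivative_transform_within_open[of _ _ _ "{..<0}"]) (use 2 in auto)
    then show ?thesis using 2 by simp
  next
    case 3
    have "((\<lambda>h::real. (max 0 h)\<^sup>2 / h) \<longlongrightarrow> 0) (at 0)"
    proof (rule tendsto_0_le[of "\<lambda>h. h" _ _ 1])
      show "\<forall>\<^sub>F h::real in at 0. norm ((max 0 h)\<^sup>2 / h) \<le> norm h * 1"
        by (intro always_eventually allI) (auto simp: max_def power2_eq_square)
    qed (rule tendsto_ident_at)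
    then show ?thesis using 3 by (simp add: DERIV_def)
  qed
qed

lemma Cc_unit_mass:
  obtains \<theta> where "\<theta> \<in> Cc 1" "(LINT x|lebesgue. \<theta> x) = 1"
proof -
  define b where "b x = (max 0 (1 - x\<^sup>2))\<^sup>2" for x :: real
  define b' where "b' x = 2 * max 0 (1 - x\<^sup>2) * (- 2 * x)" for x :: real
  have D: "(b has_real_derivative b' x) (at x)" for x
    unfolding b_def b'_def
    by (rule DERIV_chain2[OF has_derivative_max_0_square]) (auto intro!: derivative_eq_intros)
  have sq: "1 \<le> x\<^sup>2" if "1 \<le> \<bar>x\<bar>" for x :: real using that abs_le_square_iff[of 1 x] by simp
  have b0: "b x = 0" "b' x = 0" if "1 \<le> \<bar>x\<bar>" for x using sq[OF that] by (auto simp: b_def b'_def)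
  have "b' \<in> Cc 0"
    unfolding Cc_0
  proof
    show "continuous_on UNIV b'" unfolding b'_def by (intro continuous_intros)
    show "compact (closure {x. b' x \<noteq> 0})" by (rule compact_supportI[of 1]) (rule b0)
  qed
  then have b: "b \<in> Cc 1" using Cc_SucI[OF D, of 0 1] b0 by auto
  have "(LINT x|lebesgue. b x) \<noteq> 0"
  proof
    assume "(LINT x|lebesgue. b x) = 0"
    moreover have "AE x in lebesgue. 0 \<le> b x" by (simp add: b_def)
    ultimately have "AE x in lebesgue. b x = 0"
      using integral_nonneg_eq_0_iff_AE[OF integrable_test_only[OF b]] by blast
    from AE_lebesgue_ex[OF this, of 0 1] obtain x :: real where x: "0 < x" "x < 1" "b x = 0" by auto
    then have "x\<^sup>2 < 1" using abs_square_less_1[of x] by simp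
    then show False using x(3) by (auto simp: b_def max_def split: if_splits)
  qed
  then have "(LINT x|lebesgue. (0::real) - (- 1 / (LINT x|lebesgue. b x)) * b x) = 1" by simp
  moreover have "(\<lambda>x. 0 - (- 1 / (LINT x|lebesgue. b x)) * b x) \<in> Cc 1"
    by (intro Cc_lincomb b) (use Cc_lincomb[OF b b, of 1] in simp)
  ultimately show ?thesis by (intro that)
qed

text \<open>
  Steep trapezoids converge boundedly to the indicator function of a closed interval, so all integrals of
  \<open>h\<close> over intervals vanish.
\<close>

lemma AE_zero_if_orthogonal_to_Cc:
  assumes h: "locally_integrable h" and z: "\<And>\<phi>. \<phi> \<in> Cc 0 \<Longrightarrow> (LINT x|lebesgue. h x * \<phi> x) = 0"
  shows "AE x in lebesgue. h x = 0"
proof -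
  have Icc: "(LINT s:{c..d}|lebesgue. h s) = 0" if "c \<le> d" for c d
  proof -
    define \<phi> where "\<phi> n x = max 0 (1 - real (Suc n) * max 0 (max (c - x) (x - d)))" for n x
    have supp: "\<phi> n x = 0" if "x \<notin> {c-1..d+1}" for n x
    proof -
      have "1 \<le> max 0 (max (c - x) (x - d))" using that by auto
      then have "1 * 1 \<le> real (Suc n) * max 0 (max (c - x) (x - d))" by (intro mult_mono) auto
      then show ?thesis by (simp add: \<phi>_def)
    qed
    have C: "\<phi> n \<in> Cc 0" for n
      unfolding Cc_0
    proof
      show "continuous_on UNIV (\<phi> n)" unfolding \<phi>_def by (intro continuous_intros)
      show "compact (closure {x. \<phi> n x \<noteq> 0})"
        by (rule compact_supportI[of "\<bar>c\<bar> + \<bar>d\<bar> + 2"], rule supp) auto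
    qed
    have b: "0 \<le> \<phi> n x" "\<phi> n x \<le> 1" for n x by (auto simp: \<phi>_def)
    have lim: "(\<lambda>n. \<phi> n x) \<longlonglongrightarrow> indicat_real {c..d} x" for x
    proof (cases "x \<in> {c..d}")
      case True then show ?thesis by (simp add: \<phi>_def)
    next
      case False
      define m where "m = max 0 (max (c - x) (x - d))"
      have m: "m > 0" using False by (auto simp: m_def)
      obtain N :: nat where N: "1 / m < real N" using reals_Archimedean2 by blast
      have "\<phi> n x = 0" if "n \<ge> N" for n
      proof -
        have "1 / m < real (Suc n)" using N that by simp
        then have "1 < real (Suc n) * m" using m by (simp add: field_simps)
        then show ?thesis by (simp add: \<phi>_def m_def)
      qed
      then have "\<forall>\<^sub>F n in sequentially. \<phi> n x = 0" by (rule eventually_sequentiallyI)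
      then show ?thesis using False by (simp add: tendsto_eventually)
    qed
    have i: "integrable lebesgue (\<lambda>x. indicat_real {c-1..d+1} x *\<^sub>R \<bar>h x\<bar>)"
      using h set_integrable_abs unfolding locally_integrable_def set_integrable_def[symmetric] by blast
    have "(\<lambda>n. LINT x|lebesgue. h x * \<phi> n x) \<longlonglongrightarrow> (LINT x|lebesgue. indicat_real {c..d} x *\<^sub>R h x)"
    proof (rule integral_dominated_convergence[OF _ _ i])
      have "set_integrable lebesgue {c..d} h" using h by (simp add: locally_integrable_def)
      then show "(\<lambda>x. indicat_real {c..d} x *\<^sub>R h x) \<in> borel_measurable lebesgue"
        unfolding set_integrable_def by blast
      show "(\<lambda>x. h x * \<phi> n x) \<in> borel_measurable lebesgue" for n
        using integrable_test[OF h C] by blast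
      show "AE x in lebesgue. (\<lambda>n. h x * \<phi> n x) \<longlonglongrightarrow> indicat_real {c..d} x *\<^sub>R h x"
        using tendsto_mult[OF tendsto_const lim] by (auto simp: mult.commute)
      show "AE x in lebesgue. norm (h x * \<phi> n x) \<le> indicat_real {c-1..d+1} x *\<^sub>R \<bar>h x\<bar>" for n
      proof (rule AE_I2)
        fix x show "norm (h x * \<phi> n x) \<le> indicat_real {c-1..d+1} x *\<^sub>R \<bar>h x\<bar>"
          using supp[of x n] b[of n x] by (auto simp: indicator_def abs_mult mult_left_le)
      qed
    qed
    then show ?thesis
      unfolding set_lebesgue_integral_def z[OF C] by (simp add: LIMSEQ_const_iff)
  qed
  have "AE x in lebesgue. x \<in> {- real n..real n} \<longrightarrow> h x = 0" for n
    by (rule AE_zero_if_zero_integrals) (use h Icc in \<open>auto simp: locally_integrable_def\<close>)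
  then show ?thesis by (rule AE_if_AE_on_Icc)
qed

lemma locally_integrable_diff:
  "locally_integrable f \<Longrightarrow> locally_integrable g \<Longrightarrow> locally_integrable (\<lambda>x. f x - g x)"
  unfolding locally_integrable_def by auto

text \<open>
  After subtraction of a multiple of a fixed \<open>\<theta>\<close> of unit mass, every continuous test function is the
  derivative of a test function. The constant is therefore the pairing of \<open>h\<close> with \<open>\<theta>\<close>.
\<close>

lemma du_Bois_Reymond_1:
  assumes h: "locally_integrable h" and z: "\<And>\<phi>. \<phi> \<in> Cc 1 \<Longrightarrow> (LINT x|lebesgue. h x * deriv \<phi> x) = 0"
  obtains c where "AE x in lebesgue. h x = c"
proof -
  obtain \<theta> where \<theta>1: "\<theta> \<in> Cc 1" and m: "(LINT x|lebesgue. \<theta> x) = 1" using Cc_unit_mass .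
  have \<theta>: "\<theta> \<in> Cc 0" using \<theta>1 Cc_Suc_subset[of 0] by auto
  define c where "c = (LINT x|lebesgue. h x * \<theta> x)"
  have h': "locally_integrable (\<lambda>x. h x - c)"
    by (intro locally_integrable_diff h locally_integrable_continuous continuous_intros)
  have "(LINT x|lebesgue. (h x - c) * \<phi> x) = 0" if \<phi>: "\<phi> \<in> Cc 0" for \<phi>
  proof -
    define a where "a = (LINT x|lebesgue. \<phi> x)"
    have "(LINT x|lebesgue. \<phi> x - a * \<theta> x) = 0"
      using integrable_test_only[OF \<phi>] integrable_test_only[OF \<theta>] m by (simp add: a_def)
    then obtain \<Phi> where \<Phi>: "\<Phi> \<in> Cc (Suc 0)" "deriv \<Phi> = (\<lambda>x. \<phi> x - a * \<theta> x)"
      using Cc_primitive[OF Cc_lincomb[OF \<phi> \<theta>, of a]] by metis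
    have "0 = (LINT x|lebesgue. h x * \<phi> x - a * (h x * \<theta> x))"
      using z[of \<Phi>] \<Phi> by (simp add: algebra_simps)
    also have "\<dots> = (LINT x|lebesgue. h x * \<phi> x) - a * c"
      using integrable_test[OF h \<phi>] integrable_test[OF h \<theta>] by (simp add: c_def)
    also have "\<dots> = (LINT x|lebesgue. h x * \<phi> x - c * \<phi> x)"
      using integrable_test[OF h \<phi>] integrable_test_only[OF \<phi>] by (simp add: a_def)
    finally show ?thesis by (simp add: algebra_simps)
  qed
  from AE_zero_if_orthogonal_to_Cc[OF h' this] show ?thesis by (intro that[of c]) simp
qed

text \<open>
  The same subtraction, one derivative higher, reduces the second-order statement to the first-order one for
  \<open>h(x) - b x\<close>.
\<close>

lemma du_Bois_Reymond_2:
  assumes h: "locally_integrable h"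
    and z: "\<And>\<psi>. \<psi> \<in> Cc 2 \<Longrightarrow> (LINT x|lebesgue. h x * deriv (deriv \<psi>) x) = 0"
  obtains b c where "AE x in lebesgue. h x = b * x + c"
proof -
  obtain \<theta> where \<theta>: "\<theta> \<in> Cc (Suc 0)" and m: "(LINT x|lebesgue. \<theta> x) = 1" using Cc_unit_mass by auto
  define b where "b = - (LINT x|lebesgue. h x * deriv \<theta> x)"
  have h': "locally_integrable (\<lambda>x. h x - b * x)"
    by (intro locally_integrable_diff h locally_integrable_continuous continuous_intros)
  have "(LINT x|lebesgue. (h x - b * x) * deriv \<phi> x) = 0" if "\<phi> \<in> Cc 1" for \<phi>
  proof -
    have \<phi>: "\<phi> \<in> Cc (Suc 0)" using that by simp
    define a where "a = (LINT x|lebesgue. \<phi> x)"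
    have "(LINT x|lebesgue. \<phi> x - a * \<theta> x) = 0"
      using integrable_test_only[OF \<phi>] integrable_test_only[OF \<theta>] m by (simp add: a_def)
    then obtain \<Phi> where \<Phi>: "\<Phi> \<in> Cc (Suc (Suc 0))" "deriv \<Phi> = (\<lambda>x. \<phi> x - a * \<theta> x)"
      using Cc_primitive[OF Cc_lincomb[OF \<phi> \<theta>, of a]] by metis
    have dd: "deriv (deriv \<Phi>) = (\<lambda>x. deriv \<phi> x - a * deriv \<theta> x)"
      unfolding \<Phi>(2)
      by (rule ext, rule DERIV_imp_deriv)
        (auto intro!: derivative_eq_intros Cc_Suc_deriv[OF \<phi>] Cc_Suc_deriv[OF \<theta>])
    have "0 = (LINT x|lebesgue. h x * deriv \<phi> x - a * (h x * deriv \<theta> x))"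
    proof -
      have "(LINT x|lebesgue. h x * (deriv \<phi> x - a * deriv \<theta> x)) = 0"
        using z[of \<Phi>] \<Phi>(1) unfolding dd by (simp add: numeral_2_eq_2)
      then show ?thesis by (simp add: algebra_simps)
    qed
    also have "\<dots> = (LINT x|lebesgue. h x * deriv \<phi> x) + a * b"
      using integrable_test[OF h Cc_deriv[OF \<phi>]] integrable_test[OF h Cc_deriv[OF \<theta>]] by (simp add: b_def)
    also have "a * b = - (LINT x|lebesgue. (b * x) * deriv \<phi> x)"
    proof -
      have "ac_primitive UNIV (\<lambda>x. b * x) (\<lambda>x. b)"
        by (rule ac_primitive_C1) (auto intro!: derivative_eq_intros)
      from integral_by_parts_test[OF this _ \<phi>] show ?thesis
        by (simp add: a_def locally_integrable_continuous)
    qed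
    also have "(LINT x|lebesgue. h x * deriv \<phi> x) + - (LINT x|lebesgue. (b * x) * deriv \<phi> x)
        = (LINT x|lebesgue. h x * deriv \<phi> x - (b * x) * deriv \<phi> x)"
      using integrable_test[OF h Cc_deriv[OF \<phi>]]
        integrable_test[OF locally_integrable_continuous[of "\<lambda>x. b * x"] Cc_deriv[OF \<phi>]]
      by (simp add: continuous_intros)
    finally show ?thesis by (simp add: algebra_simps)
  qed
  from du_Bois_Reymond_1[OF h' this] obtain c where "AE x in lebesgue. h x - b * x = c" .
  then have "AE x in lebesgue. h x = b * x + c" by eventually_elim simp
  then show ?thesis by (rule that)
qed

section \<open>Integrability at infinity\<close>

lemma ac_primitive_locally_integrable: "ac_primitive UNIV F f \<Longrightarrow> locally_integrable f"
  unfolding locally_integrable_def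
proof (intro allI)
  fix a b assume F: "ac_primitive UNIV F f"
  show "set_integrable lebesgue {a..b} f"
    by (cases "a \<le> b") (auto intro: ac_primitive_integrable[OF F])
qed

lemma ac_primitive_constant_imp_AE_zero:
  assumes F: "ac_primitive UNIV F f" and c: "\<And>x y. F x = F y"
  shows "AE x in lebesgue. f x = 0"
proof -
  have "AE x in lebesgue. x \<in> {- real n..real n} \<longrightarrow> f x = 0" for n
  proof (rule AE_zero_if_zero_integrals)
    show "set_integrable lebesgue {- real n..real n} f"
      using ac_primitive_locally_integrable[OF F] by (simp add: locally_integrable_def)
    show "(LINT s:{x..y}|lebesgue. f s) = 0" if "x \<le> y" for x y
      using ac_primitive_integral[OF F that] c[of y x] by simp
  qed
  then show ?thesis by (rule AE_if_AE_on_Icc)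
qed

lemma continuous_AE_eq_const:
  fixes f :: "real \<Rightarrow> real"
  assumes c: "continuous_on UNIV f" and ae: "AE x in lebesgue. f x = k"
  shows "f x = k"
proof (rule ccontr)
  assume "f x \<noteq> k"
  have "open {x. f x \<noteq> k}"
    using c by (intro open_Collect_neq) (auto intro: continuous_intros)
  then obtain e where e: "e > 0" "\<And>y. dist y x < e \<Longrightarrow> f y \<noteq> k"
    using \<open>f x \<noteq> k\<close> by (auto simp: open_dist)
  from AE_lebesgue_ex[OF ae, of "x - e" "x + e"] e(1)
  obtain y where "x - e < y" "y < x + e" "f y = k" by auto
  then show False using e(2)[of y] by (auto simp: dist_real_def)
qed

lemma ac_primitive_le_integral:
  assumes f: "integrable lebesgue f" "AE x in lebesgue. 0 \<le> f x"
    and L: "ac_primitive UNIV L g" "a \<le> b" and le: "AE x in lebesgue. x \<in> {a..b} \<longrightarrow> g x \<le> f x"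
  shows "L b - L a \<le> (LINT x|lebesgue. f x)"
proof -
  have "L b - L a = (LINT x:{a..b}|lebesgue. g x)" using ac_primitive_integral[OF L] by simp
  also have "\<dots> \<le> (LINT x|lebesgue. f x)"
    unfolding set_lebesgue_integral_def
  proof (rule integral_mono_AE)
    show "integrable lebesgue (\<lambda>x. indicat_real {a..b} x *\<^sub>R g x)"
      using ac_primitive_integrable[OF L] by (simp add: set_integrable_def)
    show "AE x in lebesgue. indicat_real {a..b} x *\<^sub>R g x \<le> f x"
      using f(2) le by eventually_elim (auto simp: indicator_def)
  qed (rule f(1))
  finally show ?thesis .
qed

lemma
  fixes a :: real
  assumes f: "integrable lebesgue f" "AE x in lebesgue. 0 \<le> f x" and d: "\<delta> > (0::real)"
  shows integrable_not_bounded_below_right: "\<not> (AE x in lebesgue. a \<le> x \<longrightarrow> \<delta> \<le> f x)"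
    and integrable_not_bounded_below_left: "\<not> (AE x in lebesgue. x \<le> a \<longrightarrow> \<delta> \<le> f x)"
proof -
  define I where "I = (LINT x|lebesgue. f x)"
  have L: "ac_primitive UNIV (\<lambda>x. \<delta> * x) (\<lambda>x. \<delta>)"
    by (rule ac_primitive_C1) (auto intro!: derivative_eq_intros)
  define r where "r = (\<bar>I\<bar> + 1) / \<delta>"
  have r: "r \<ge> 0" "\<delta> * r = \<bar>I\<bar> + 1" using d by (auto simp: r_def)
  show "\<not> (AE x in lebesgue. a \<le> x \<longrightarrow> \<delta> \<le> f x)"
  proof
    assume "AE x in lebesgue. a \<le> x \<longrightarrow> \<delta> \<le> f x"
    then have "\<delta> * (a + r) - \<delta> * a \<le> I"
      unfolding I_def by (intro ac_primitive_le_integral[OF f L]) (use r in \<open>auto elim: eventually_mono\<close>)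
    then show False using r by (simp add: algebra_simps)
  qed
  show "\<not> (AE x in lebesgue. x \<le> a \<longrightarrow> \<delta> \<le> f x)"
  proof
    assume "AE x in lebesgue. x \<le> a \<longrightarrow> \<delta> \<le> f x"
    then have "\<delta> * a - \<delta> * (a - r) \<le> I"
      unfolding I_def by (intro ac_primitive_le_integral[OF f L]) (use r in \<open>auto elim: eventually_mono\<close>)
    then show False using r by (simp add: algebra_simps)
  qed
qed

lemma ln_1_plus_square_unbounded: "\<exists>y\<ge>b. K < ln (1 + y\<^sup>2)" for b K :: real
proof -
  define y where "y = max b (exp \<bar>K\<bar>)"
  have "exp \<bar>K\<bar> \<le> y" by (simp add: y_def)
  moreover have "1 \<le> y" using \<open>exp \<bar>K\<bar> \<le> y\<close> one_le_exp_iff[of "\<bar>K\<bar>"] by linarith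
  then have "y \<le> y\<^sup>2" by (simp add: power2_eq_square)
  ultimately have "exp \<bar>K\<bar> < 1 + y\<^sup>2" by linarith
  then have "\<bar>K\<bar> < ln (1 + y\<^sup>2)" by (metis exp_gt_zero less_trans ln_exp ln_less_cancel_iff)
  then show ?thesis by (intro exI[of _ y]) (auto simp: y_def)
qed

text \<open>
  An integrable function cannot dominate \<open>\<delta> / \<bar>x\<bar>\<close> near infinity. The comparison is made with
  \<open>\<delta> x / (1 + x\<^sup>2)\<close>, whose primitive \<open>\<delta> / 2 \<cdot> ln (1 + x\<^sup>2)\<close> is smooth on the whole line and even, so that one
  function serves both ends.
\<close>

lemma
  fixes a :: real
  assumes f: "integrable lebesgue f" "AE x in lebesgue. 0 \<le> f x" and d: "\<delta> > (0::real)"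
  shows integrable_not_ge_inverse_right: "\<not> (AE x in lebesgue. a \<le> x \<longrightarrow> \<delta> \<le> \<bar>x\<bar> * f x)"
    and integrable_not_ge_inverse_left: "\<not> (AE x in lebesgue. x \<le> a \<longrightarrow> \<delta> \<le> \<bar>x\<bar> * f x)"
proof -
  define I where "I = (LINT x|lebesgue. f x)"
  define L where "L x = \<delta> / 2 * ln (1 + x\<^sup>2)" for x
  have pos: "0 < 1 + x\<^sup>2" for x :: real by (simp add: add_pos_nonneg)
  have L: "ac_primitive UNIV L (\<lambda>x. \<delta> * x / (1 + x\<^sup>2))"
  proof (rule ac_primitive_C1)
    fix x :: real
    have "((\<lambda>x. ln (1 + x\<^sup>2)) has_real_derivative (2 * x) / (1 + x\<^sup>2)) (at x)"
      using pos[of x] by (auto intro!: derivative_eq_intros)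
    from DERIV_cmult[OF this, of "\<delta> / 2"]
    show "(L has_real_derivative \<delta> * x / (1 + x\<^sup>2)) (at x)" by (simp add: L_def[abs_def])
  next
    show "continuous_on UNIV (\<lambda>x. \<delta> * x / (1 + x\<^sup>2))"
      using pos by (intro continuous_intros) (auto simp: less_imp_neq[symmetric])
  qed
  have key: "\<delta> * \<bar>x\<bar> / (1 + x\<^sup>2) \<le> y" if "\<delta> \<le> \<bar>x\<bar> * y" for x y
  proof -
    have "0 < \<bar>x\<bar> * y" using that d by linarith
    then have "0 < y" by (simp add: zero_less_mult_iff)
    have "\<delta> * \<bar>x\<bar> \<le> (\<bar>x\<bar> * y) * \<bar>x\<bar>" by (intro mult_right_mono that) auto
    also have "\<dots> = y * x\<^sup>2" by (simp add: power2_eq_square algebra_simps flip: abs_mult)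
    also have "\<dots> \<le> y * (1 + x\<^sup>2)" using \<open>0 < y\<close> by simp
    finally show ?thesis using pos[of x] by (simp add: divide_le_eq)
  qed
  have even: "L (-x) = L x" for x by (simp add: L_def)
  obtain y where y: "y \<ge> max \<bar>a\<bar> 1" and K: "(I + L (max \<bar>a\<bar> 1)) * 2 / \<delta> < ln (1 + y\<^sup>2)"
    using ln_1_plus_square_unbounded by blast
  have big: "I + L (max \<bar>a\<bar> 1) < L y" using K d by (simp add: L_def field_simps)
  show "\<not> (AE x in lebesgue. a \<le> x \<longrightarrow> \<delta> \<le> \<bar>x\<bar> * f x)"
  proof
    assume "AE x in lebesgue. a \<le> x \<longrightarrow> \<delta> \<le> \<bar>x\<bar> * f x"
    then have "AE x in lebesgue. x \<in> {max \<bar>a\<bar> 1..y} \<longrightarrow> \<delta> * x / (1 + x\<^sup>2) \<le> f x"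
    proof eventually_elim
      case (elim x) then show ?case using key[of x "f x"] by auto
    qed
    then have "L y - L (max \<bar>a\<bar> 1) \<le> I"
      unfolding I_def by (rule ac_primitive_le_integral[OF f L y])
    then show False using big by simp
  qed
  show "\<not> (AE x in lebesgue. x \<le> a \<longrightarrow> \<delta> \<le> \<bar>x\<bar> * f x)"
  proof
    assume "AE x in lebesgue. x \<le> a \<longrightarrow> \<delta> \<le> \<bar>x\<bar> * f x"
    then have "AE x in lebesgue. x \<in> {-y..- max \<bar>a\<bar> 1} \<longrightarrow> - (\<delta> * x / (1 + x\<^sup>2)) \<le> f x"
    proof eventually_elim
      case (elim x) then show ?case using key[of x "f x"] by auto
    qed
    then have "- L (- max \<bar>a\<bar> 1) - - L (-y) \<le> I"
      unfolding I_def by (rule ac_primitive_le_integral[OF f ac_primitive_uminus[OF L], rotated]) (use y in auto)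
    then show False using big even by simp
  qed
qed

section \<open>The flux form of the stationary equation\<close>

lemma primitive_deriv:
  assumes "admissible D"
  shows "(primitive D has_real_derivative D u) (at u)"
proof -
  define b where "b = \<bar>u\<bar> + 1"
  have "continuous_on {-b..b} D" using assms continuous_on_subset unfolding admissible_def by blast
  then have "((\<lambda>u. LBINT y=0..u. D y) has_vector_derivative D u) (at u within {-b..b})"
    using interval_integral_FTC2[of "-b" 0 b D u] by (auto simp: b_def zero_ereal_def)
  then have "(primitive D has_real_derivative D u) (at u within {-b..b})"
    unfolding primitive_def[abs_def] by (simp add: has_real_derivative_iff_has_vector_derivative)
  then have "(primitive D has_real_derivative D u) (at u within {-b<..<b})"
    by (rule DERIV_subset) auto
  then show ?thesis by (subst (asm) at_within_open) (auto simp: b_def)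
qed

lemma primitive_0 [simp]: "primitive D 0 = 0"
  by (simp add: primitive_def zero_ereal_def[symmetric])

lemma primitive_mono:
  assumes "admissible D"
  shows "mono (primitive D)"
proof
  fix x y :: real assume "x \<le> y"
  then show "primitive D x \<le> primitive D y"
    by (rule DERIV_nonneg_imp_nondecreasing)
      (use primitive_deriv[OF assms] assms in \<open>auto simp: admissible_def\<close>)
qed

lemma primitive_continuous: "admissible D \<Longrightarrow> continuous_on S (primitive D)"
  using primitive_deriv DERIV_isCont by (metis continuous_at_imp_continuous_on)

lemma primitive_lipschitz:
  assumes "admissible D"
  obtains M where "M \<ge> 0" "\<And>u v. \<bar>primitive D u - primitive D v\<bar> \<le> M * \<bar>u - v\<bar>"
proof -
  obtain M where M: "\<And>s. \<bar>D s\<bar> \<le> M"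
    using assms unfolding admissible_def bounded_real by blast
  have "\<bar>primitive D u - primitive D v\<bar> \<le> M * \<bar>u - v\<bar>" for u v
    using field_differentiable_bound[of UNIV "primitive D" D M u v] primitive_deriv[OF assms] M by auto
  moreover have "M \<ge> 0" using M[of 0] by linarith
  ultimately show ?thesis by (intro that)
qed

lemma L2_on_imp_integrable_Icc:
  fixes U :: "real \<Rightarrow> real"
  assumes "L2_on {a..b} U"
  shows "set_integrable lebesgue {a..b} U"
proof (rule set_integrable_bound)
  show "set_integrable lebesgue {a..b} (\<lambda>x. 1 + (U x)\<^sup>2)"
    using assms absolutely_integrable_continuous_real[of a b "\<lambda>_. 1"]
    by (intro set_integral_add) (auto simp: L2_on_def)
  show "AE x in lebesgue. x \<in> {a..b} \<longrightarrow> norm (U x) \<le> norm (1 + (U x)\<^sup>2)"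
  proof (intro AE_I2 impI)
    fix x
    have "0 \<le> (\<bar>U x\<bar> - 1)\<^sup>2" by simp
    then have "2 * \<bar>U x\<bar> \<le> 1 + (U x)\<^sup>2" by (simp add: power2_eq_square algebra_simps)
    then show "norm (U x) \<le> norm (1 + (U x)\<^sup>2)" by simp
  qed
qed (use assms in \<open>simp add: L2_on_def\<close>)

lemma L2_loc_locally_integrable: "L2_loc U \<Longrightarrow> locally_integrable U"
  unfolding L2_loc_def locally_integrable_def using L2_on_imp_integrable_Icc by blast

lemma L2_UNIV_iff: "L2_on UNIV w \<longleftrightarrow> w \<in> borel_measurable lebesgue \<and> integrable lebesgue (\<lambda>x. (w x)\<^sup>2)"
  by (simp add: L2_on_def set_borel_measurable_def set_integrable_def)

lemma L2_UNIV_locally_integrable: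
  assumes "L2_on UNIV w" shows "locally_integrable w"
  unfolding locally_integrable_def
proof (intro allI L2_on_imp_integrable_Icc)
  fix a b :: real
  have m: "w \<in> borel_measurable lebesgue" and i: "integrable lebesgue (\<lambda>x. (w x)\<^sup>2)"
    using assms by (auto simp: L2_UNIV_iff)
  show "L2_on {a..b} w"
    unfolding L2_on_def set_borel_measurable_def set_integrable_def
    using integrable_mult_indicator[OF _ i, of "{a..b}"]
      borel_measurable_times[OF borel_measurable_indicator m, of "{a..b}"] by simp
qed

lemma primitive_locally_integrable:
  assumes D: "admissible D" and U: "locally_integrable U"
  shows "locally_integrable (\<lambda>x. primitive D (U x))"
  unfolding locally_integrable_def
proof (intro allI)
  fix a b :: real
  obtain M where M: "M \<ge> 0" "\<And>u v. \<bar>primitive D u - primitive D v\<bar> \<le> M * \<bar>u - v\<bar>"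
    using primitive_lipschitz[OF D] by blast
  have i: "set_integrable lebesgue {a..b} U" using U by (simp add: locally_integrable_def)
  show "set_integrable lebesgue {a..b} (\<lambda>x. primitive D (U x))"
  proof (rule set_integrable_bound)
    show "set_integrable lebesgue {a..b} (\<lambda>x. M * U x)" using i by simp
    have "(\<lambda>x. primitive D (indicat_real {a..b} x *\<^sub>R U x)) \<in> borel_measurable lebesgue"
      using i primitive_continuous[OF D, of UNIV]
      by (intro borel_measurable_continuous_on[of "primitive D"]) (auto simp: set_integrable_def)
    moreover have "(\<lambda>x. primitive D (indicat_real {a..b} x *\<^sub>R U x)) = (\<lambda>x. indicat_real {a..b} x *\<^sub>R primitive D (U x))"
      by (auto simp: indicator_def)
    ultimately show "set_borel_measurable lebesgue {a..b} (\<lambda>x. primitive D (U x))"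
      by (simp add: set_borel_measurable_def)
    show "AE x in lebesgue. x \<in> {a..b} \<longrightarrow> norm (primitive D (U x)) \<le> norm (M * U x)"
      using M(2)[of _ 0] M(1) by (auto simp: abs_mult)
  qed
qed

text \<open>
  Formally \<open>F = A(U)' + s U / 2\<close>, so that the two conditions on \<open>W\<close> and \<open>F\<close> together say
  \<open>A(U)'' + s / 2 \<cdot> U' = 0\<close> without differentiating \<open>U\<close>.
\<close>

definition flux_form :: "(real \<Rightarrow> real) \<Rightarrow> (real \<Rightarrow> real) \<Rightarrow> (real \<Rightarrow> real) \<Rightarrow> (real \<Rightarrow> real) \<Rightarrow> bool" where
  "flux_form A U W F \<longleftrightarrow> (AE y in lebesgue. A (U y) = W y) \<and>
     ac_primitive UNIV W (\<lambda>s. F s - s / 2 * U s) \<and> ac_primitive UNIV F (\<lambda>s. U s / 2)"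

lemma
  assumes "flux_form A U W F"
  shows flux_form_AE: "AE y in lebesgue. A (U y) = W y"
    and flux_form_W: "ac_primitive UNIV W (\<lambda>s. F s - s / 2 * U s)"
    and flux_form_F: "ac_primitive UNIV F (\<lambda>s. U s / 2)"
  using assms by (auto simp: flux_form_def)

text \<open>
  Let \<open>F\<^sub>0\<close> be a primitive of \<open>U / 2\<close> and \<open>W\<^sub>0\<close> one of \<open>F\<^sub>0 - s U / 2\<close>. Integrating by parts twice, the
  weak equation becomes the orthogonality of \<open>A(U) - W\<^sub>0\<close> to all second derivatives of test functions, so
  this difference is affine. Its slope is absorbed into \<open>F\<close>, the affine function itself into \<open>W\<close>.
\<close>

lemma stationary_profile_flux_form:
  assumes D: "admissible D" and U: "stationary_profile D Um Up U"
  obtains W F where "flux_form (primitive D) U W F"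
proof -
  let ?A = "primitive D"
  have Ul: "locally_integrable U"
    using U by (auto simp: stationary_profile_def intro: L2_loc_locally_integrable)
  have U2: "locally_integrable (\<lambda>s. U s / 2)" using Ul by (simp add: locally_integrable_def)
  have sU: "locally_integrable (\<lambda>s. s / 2 * U s)"
    using locally_integrable_mult_continuous[OF Ul, of "\<lambda>s. s / 2"] by (simp add: mult.commute continuous_intros)
  obtain F0 where F0: "ac_primitive UNIV F0 (\<lambda>s. U s / 2)" using ac_primitive_exists[OF U2] .
  have l0: "locally_integrable (\<lambda>s. F0 s - s / 2 * U s)"
    by (intro locally_integrable_diff sU locally_integrable_continuous ac_primitive_continuous[OF F0])
  obtain W0 where W0: "ac_primitive UNIV W0 (\<lambda>s. F0 s - s / 2 * U s)" using ac_primitive_exists[OF l0] .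
  have Al: "locally_integrable (\<lambda>y. ?A (U y))" by (rule primitive_locally_integrable[OF D Ul])
  have W0l: "locally_integrable W0" and F0l: "locally_integrable F0"
    by (intro locally_integrable_continuous ac_primitive_continuous[OF W0] ac_primitive_continuous[OF F0])+
  have "(LINT y|lebesgue. (?A (U y) - W0 y) * deriv (deriv \<psi>) y) = 0" if \<psi>: "\<psi> \<in> Cc 2" for \<psi>
  proof -
    have \<psi>2: "\<psi> \<in> Cc (Suc (Suc 0))" using \<psi> by (simp add: numeral_2_eq_2)
    note \<psi>' = Cc_deriv[OF \<psi>2] and \<psi>'' = Cc_deriv[OF Cc_deriv[OF \<psi>2]]
    have dz: "deriv (\<lambda>z. z / 2 * \<psi> z) y = \<psi> y / 2 + y / 2 * deriv \<psi> y" for y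
      by (rule DERIV_imp_deriv) (auto intro!: derivative_eq_intros Cc_Suc_deriv[OF \<psi>2])
    have i1: "integrable lebesgue (\<lambda>y. ?A (U y) * deriv (deriv \<psi>) y)" by (rule integrable_test[OF Al \<psi>''])
    have i2: "integrable lebesgue (\<lambda>y. U y / 2 * \<psi> y)" by (rule integrable_test[OF U2 \<psi>2])
    have i3: "integrable lebesgue (\<lambda>y. y / 2 * U y * deriv \<psi> y)" by (rule integrable_test[OF sU \<psi>'])
    have i4: "integrable lebesgue (\<lambda>y. W0 y * deriv (deriv \<psi>) y)" by (rule integrable_test[OF W0l \<psi>''])
    have i5: "integrable lebesgue (\<lambda>y. F0 y * deriv \<psi> y)" by (rule integrable_test[OF F0l \<psi>'])
    have "0 = (LINT y|lebesgue. ?A (U y) * deriv (deriv \<psi>) y - U y * deriv (\<lambda>z. z / 2 * \<psi> z) y)"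
      using U \<psi> by (simp add: stationary_profile_def)
    also have "\<dots> = (LINT y|lebesgue. ?A (U y) * deriv (deriv \<psi>) y - (U y / 2 * \<psi> y + y / 2 * U y * deriv \<psi> y))"
      unfolding dz by (rule Bochner_Integration.integral_cong) (auto simp: algebra_simps)
    also have "\<dots> = (LINT y|lebesgue. ?A (U y) * deriv (deriv \<psi>) y)
        - ((LINT y|lebesgue. U y / 2 * \<psi> y) + (LINT y|lebesgue. y / 2 * U y * deriv \<psi> y))"
      by (subst Bochner_Integration.integral_diff[OF i1 Bochner_Integration.integrable_add[OF i2 i3]])
        (subst Bochner_Integration.integral_add[OF i2 i3], simp)
    also have "(LINT y|lebesgue. U y / 2 * \<psi> y) = - (LINT y|lebesgue. F0 y * deriv \<psi> y)"
      using integral_by_parts_test[OF F0 U2 \<psi>2] by simp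
    also have "- (LINT y|lebesgue. F0 y * deriv \<psi> y) + (LINT y|lebesgue. y / 2 * U y * deriv \<psi> y)
        = - (LINT y|lebesgue. (F0 y - y / 2 * U y) * deriv \<psi> y)"
      using Bochner_Integration.integral_diff[OF i5 i3] by (simp add: left_diff_distrib)
    also have "\<dots> = (LINT y|lebesgue. W0 y * deriv (deriv \<psi>) y)"
      using integral_by_parts_test[OF W0 l0 \<psi>'] by simp
    also have "(LINT y|lebesgue. ?A (U y) * deriv (deriv \<psi>) y) - (LINT y|lebesgue. W0 y * deriv (deriv \<psi>) y)
       = (LINT y|lebesgue. (?A (U y) - W0 y) * deriv (deriv \<psi>) y)"
      using Bochner_Integration.integral_diff[OF i1 i4] by (simp add: left_diff_distrib)
    finally show ?thesis by simp
  qed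
  then obtain b c where bc: "AE y in lebesgue. ?A (U y) - W0 y = b * y + c"
    using du_Bois_Reymond_2[OF locally_integrable_diff[OF Al W0l]] by metis
  define F where "F y = F0 y + b" for y
  define W where "W y = W0 y + (b * y + c)" for y
  have lin: "ac_primitive UNIV (\<lambda>y. b * y + c) (\<lambda>y. b)"
    by (rule ac_primitive_C1) (auto intro!: derivative_eq_intros)
  have "ac_primitive UNIV W (\<lambda>s. F s - s / 2 * U s)"
    using ac_primitive_add[OF W0 lin] by (simp add: W_def[abs_def] F_def algebra_simps)
  moreover have "ac_primitive UNIV F (\<lambda>s. U s / 2)"
    using ac_primitive_add_const[OF F0] by (simp add: F_def[abs_def])
  moreover have "AE y in lebesgue. ?A (U y) = W y" using bc by eventually_elim (simp add: W_def)
  ultimately show ?thesis by (intro that[of W F]) (simp add: flux_form_def)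
qed

text \<open>
  The difference of \<open>v\<close> and any primitive of \<open>w\<close> is orthogonal to all derivatives of test functions, hence
  constant almost everywhere.
\<close>

lemma H1_deriv_primitive:
  assumes "H1_deriv v w"
  obtains z where "ac_primitive UNIV z w" "AE y in lebesgue. v y = z y" "integrable lebesgue (\<lambda>y. (z y)\<^sup>2)"
proof -
  have v: "L2_on UNIV v" and w: "L2_on UNIV w" using assms by (auto simp: H1_deriv_def)
  note vl = L2_UNIV_locally_integrable[OF v] and wl = L2_UNIV_locally_integrable[OF w]
  obtain Z where Z: "ac_primitive UNIV Z w" using ac_primitive_exists[OF wl] .
  have Zl: "locally_integrable Z" by (rule locally_integrable_continuous[OF ac_primitive_continuous[OF Z]])
  have "(LINT y|lebesgue. (v y - Z y) * deriv \<phi> y) = 0" if "\<phi> \<in> Cc 1" for \<phi>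
  proof -
    have \<phi>: "\<phi> \<in> Cc (Suc 0)" using that by simp
    have "(LINT y|lebesgue. (v y - Z y) * deriv \<phi> y)
        = (LINT y|lebesgue. v y * deriv \<phi> y) - (LINT y|lebesgue. Z y * deriv \<phi> y)"
      using Bochner_Integration.integral_diff[OF integrable_test[OF vl Cc_deriv[OF \<phi>]] integrable_test[OF Zl Cc_deriv[OF \<phi>]]]
      by (simp add: left_diff_distrib)
    also have "\<dots> = 0"
      using assms that integral_by_parts_test[OF Z wl \<phi>] by (simp add: H1_deriv_def)
    finally show ?thesis .
  qed
  then obtain c where c: "AE y in lebesgue. v y - Z y = c"
    using du_Bois_Reymond_1[OF locally_integrable_diff[OF vl Zl]] by metis
  define z where "z y = Z y + c" for y
  have z: "ac_primitive UNIV z w" unfolding z_def by (rule ac_primitive_add_const[OF Z])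
  have eq: "AE y in lebesgue. v y = z y" using c by eventually_elim (simp add: z_def)
  have m: "v \<in> borel_measurable lebesgue" using v by (simp add: L2_UNIV_iff)
  have "AE y in lebesgue. (v y)\<^sup>2 = (z y)\<^sup>2" using eq by eventually_elim simp
  then have "integrable lebesgue (\<lambda>y. (z y)\<^sup>2)"
    using v borel_measurable_AE[OF m eq] m unfolding L2_UNIV_iff
    by (subst integrable_cong_AE[where g = "\<lambda>y. (v y)\<^sup>2"]) (auto elim: eventually_mono)
  then show ?thesis using z eq by (intro that)
qed

section \<open>Uniqueness\<close>

lemma square_bound: "\<bar>x * y\<bar> \<le> x\<^sup>2 + y\<^sup>2" for x y :: real
proof -
  have "0 \<le> (\<bar>x\<bar> - \<bar>y\<bar>)\<^sup>2" by simp
  then have "2 * (\<bar>x\<bar> * \<bar>y\<bar>) \<le> x\<^sup>2 + y\<^sup>2" by (simp add: power2_eq_square algebra_simps)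
  moreover have "0 \<le> \<bar>x\<bar> * \<bar>y\<bar>" by simp
  ultimately have "\<bar>x\<bar> * \<bar>y\<bar> \<le> x\<^sup>2 + y\<^sup>2" by linarith
  then show ?thesis by (simp add: abs_mult)
qed

text \<open>
  The energy identity \<open>(z G + s z\<^sup>2 / 4)' = w G + 3/4 \<cdot> z\<^sup>2\<close> for the differences of two profiles. The flux
  equations alone give \<open>G' = z / 2 + c - s w / 2\<close> with an integration constant; it is zero because
  \<open>P = G + s z / 2\<close> satisfies \<open>P' = z + c\<close>, so \<open>P\<close> would grow linearly, whereas \<open>G\<close> and \<open>z\<close> are square
  integrable.
\<close>

lemma stationary_profile_unique:
  assumes D: "admissible D" and U1: "stationary_profile D Um Up U1" and U2: "stationary_profile D Um Up U2"
  shows "AE y in lebesgue. U1 y = U2 y"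
proof -
  let ?A = "primitive D"
  obtain W1 F1 where 1: "flux_form ?A U1 W1 F1" using stationary_profile_flux_form[OF D U1] .
  obtain W2 F2 where 2: "flux_form ?A U2 W2 F2" using stationary_profile_flux_form[OF D U2] .
  obtain v1 w1 where v1: "H1_deriv v1 w1" "AE y in lebesgue. U1 y = ubar Um Up y + w1 y"
    using U1 by (auto simp: stationary_profile_def)
  obtain v2 w2 where v2: "H1_deriv v2 w2" "AE y in lebesgue. U2 y = ubar Um Up y + w2 y"
    using U2 by (auto simp: stationary_profile_def)
  obtain z1 where z1: "ac_primitive UNIV z1 w1" "integrable lebesgue (\<lambda>y. (z1 y)\<^sup>2)"
    using H1_deriv_primitive[OF v1(1)] .
  obtain z2 where z2: "ac_primitive UNIV z2 w2" "integrable lebesgue (\<lambda>y. (z2 y)\<^sup>2)"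
    using H1_deriv_primitive[OF v2(1)] .
  define z where "z y = z1 y - z2 y" for y
  define w where "w y = U1 y - U2 y" for y
  define G where "G y = W1 y - W2 y" for y
  define \<Phi> where "\<Phi> y = F1 y - F2 y" for y
  have weq: "AE y in lebesgue. w1 y - w2 y = w y" using v1(2) v2(2) by eventually_elim (simp add: w_def)
  have z: "ac_primitive UNIV z w"
    using ac_primitive_cong_AE[OF ac_primitive_diff[OF z1(1) z2(1)], of w] weq by (simp add: z_def[abs_def])
  have diff_sq: "integrable lebesgue (\<lambda>y. (f y - g y)\<^sup>2)"
    if "integrable lebesgue (\<lambda>y. (f y)\<^sup>2)" "integrable lebesgue (\<lambda>y. (g y)\<^sup>2)"
      "f \<in> borel_measurable lebesgue" "g \<in> borel_measurable lebesgue" for f g :: "real \<Rightarrow> real"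
  proof (rule Bochner_Integration.integrable_bound[of _ "\<lambda>y. 2 * (f y)\<^sup>2 + 2 * (g y)\<^sup>2"])
    show "AE y in lebesgue. norm ((f y - g y)\<^sup>2) \<le> norm (2 * (f y)\<^sup>2 + 2 * (g y)\<^sup>2)"
    proof (rule AE_I2)
      fix y
      have "0 \<le> (f y + g y)\<^sup>2" by simp
      then have "(f y - g y)\<^sup>2 \<le> 2 * (f y)\<^sup>2 + 2 * (g y)\<^sup>2"
        by (simp add: power2_eq_square algebra_simps)
      then show "norm ((f y - g y)\<^sup>2) \<le> norm (2 * (f y)\<^sup>2 + 2 * (g y)\<^sup>2)"
        by simp
    qed
  qed (use that in auto)
  have meas_c: "f \<in> borel_measurable lebesgue" if "continuous_on UNIV f" for f :: "real \<Rightarrow> real"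
    by (intro measurable_completion) (simp add: borel_measurable_continuous_onI[OF that])
  have mz: "z \<in> borel_measurable lebesgue" by (rule meas_c[OF ac_primitive_continuous[OF z]])
  have z_sq: "integrable lebesgue (\<lambda>y. (z y)\<^sup>2)"
    unfolding z_def
    by (intro diff_sq z1 z2 meas_c ac_primitive_continuous[OF z1(1)] ac_primitive_continuous[OF z2(1)])
  have w12: "L2_on UNIV w1" "L2_on UNIV w2" using v1 v2 by (auto simp: H1_deriv_def)
  have G: "ac_primitive UNIV G (\<lambda>s. \<Phi> s - s / 2 * w s)"
  proof -
    have "(\<lambda>s. (F1 s - s / 2 * U1 s) - (F2 s - s / 2 * U2 s)) = (\<lambda>s. \<Phi> s - s / 2 * w s)"
      by (auto simp: fun_eq_iff \<Phi>_def w_def right_diff_distrib)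
    with ac_primitive_diff[OF flux_form_W[OF 1] flux_form_W[OF 2]] show ?thesis
      by (simp add: G_def[abs_def])
  qed
  have \<Phi>: "ac_primitive UNIV \<Phi> (\<lambda>s. w s / 2)"
    using ac_primitive_diff[OF flux_form_F[OF 1] flux_form_F[OF 2]]
    by (simp add: \<Phi>_def[abs_def] w_def diff_divide_distrib)
  have mG: "G \<in> borel_measurable lebesgue" by (rule meas_c[OF ac_primitive_continuous[OF G]])
  have GA: "AE y in lebesgue. G y = ?A (U1 y) - ?A (U2 y)"
    using flux_form_AE[OF 1] flux_form_AE[OF 2] by eventually_elim (simp add: G_def)
  have Gw: "AE y in lebesgue. 0 \<le> w y * G y"
    using GA
  proof eventually_elim
    case (elim y)
    show ?case
      using monoD[OF primitive_mono[OF D], of "U1 y" "U2 y"] monoD[OF primitive_mono[OF D], of "U2 y" "U1 y"]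
      unfolding elim w_def by (cases "U1 y" "U2 y" rule: le_cases) (auto intro: mult_nonneg_nonneg mult_nonpos_nonpos)
  qed
  obtain M where M: "M \<ge> 0" "\<And>u v. \<bar>?A u - ?A v\<bar> \<le> M * \<bar>u - v\<bar>" using primitive_lipschitz[OF D] by blast
  have G_sq: "integrable lebesgue (\<lambda>y. (G y)\<^sup>2)"
  proof (rule Bochner_Integration.integrable_bound[of _ "\<lambda>y. M\<^sup>2 * (w1 y - w2 y)\<^sup>2"])
    show "integrable lebesgue (\<lambda>y. M\<^sup>2 * (w1 y - w2 y)\<^sup>2)"
      using w12 by (intro integrable_mult_right diff_sq) (auto simp: L2_UNIV_iff)
    show "AE y in lebesgue. norm ((G y)\<^sup>2) \<le> norm (M\<^sup>2 * (w1 y - w2 y)\<^sup>2)"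
      using GA weq
    proof eventually_elim
      case (elim y)
      have "\<bar>G y\<bar> \<le> \<bar>M * w y\<bar>" using M elim(1) by (simp add: w_def abs_mult)
      then have "(G y)\<^sup>2 \<le> (M * w y)\<^sup>2" by (simp add: abs_le_square_iff)
      then show ?case by (simp add: elim(2) power_mult_distrib)
    qed
  qed (use mG in simp)
  define f where "f y = 2 * (G y)\<^sup>2 + 2 * (z y)\<^sup>2" for y
  have f: "integrable lebesgue f" "AE y in lebesgue. 0 \<le> f y"
    unfolding f_def using G_sq z_sq by auto
  define c where "c = \<Phi> 0 - z 0 / 2"
  have \<Phi>z: "\<Phi> y = z y / 2 + c" for y
  proof -
    have "ac_primitive UNIV (\<lambda>y. \<Phi> y - 1/2 * z y) (\<lambda>y. 0)"
      using ac_primitive_diff[OF \<Phi> ac_primitive_cmult[OF z, of "1/2"]] by simp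
    note * = ac_primitive_integral[OF this]
    show ?thesis using *[of 0 y] *[of y 0] by (cases "0 \<le> y") (auto simp: c_def)
  qed
  have half: "ac_primitive UNIV (\<lambda>y. y / a) (\<lambda>y. 1 / a)" for a :: real
    by (cases "a = 0") (auto intro!: ac_primitive_C1 derivative_eq_intros)
  \<comment> \<open>The constant \<open>c\<close> vanishes: otherwise \<open>P\<close> grows linearly, and
      \<open>\<bar>G\<bar> + \<bar>z\<bar>\<close> stays away from zero near \<open>+\<infinity>\<close>.\<close>
  define P where "P y = G y + y / 2 * z y" for y
  have P: "ac_primitive UNIV P (\<lambda>y. z y + c)"
    using ac_primitive_add[OF G ac_primitive_mult[OF half[of 2] z]]
    by (simp add: P_def[abs_def] \<Phi>z)
  have c0: "c = 0"
  proof (rule ccontr)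
    assume c: "c \<noteq> 0"
    define C where "C = (LINT y|lebesgue. (z y)\<^sup>2 / \<bar>c\<bar>)"
    have iC: "integrable lebesgue (\<lambda>y. (z y)\<^sup>2 / \<bar>c\<bar>)" using z_sq by simp
    \<comment> \<open>Young's inequality; the weight leaves three quarters of the linear growth of \<open>P\<close> intact.\<close>
    have zc: "\<bar>z y\<bar> - \<bar>c\<bar> / 4 \<le> (z y)\<^sup>2 / \<bar>c\<bar>" for y
    proof -
      have "0 \<le> (\<bar>z y\<bar> - \<bar>c\<bar> / 2)\<^sup>2" by simp
      then have "(\<bar>z y\<bar> - \<bar>c\<bar> / 4) * \<bar>c\<bar> \<le> (z y)\<^sup>2"
        by (simp add: power2_eq_square algebra_simps)
      then show ?thesis using c by (simp add: le_divide_eq)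
    qed
    have lin: "ac_primitive UNIV (\<lambda>y. a * y) (\<lambda>y. a)" for a :: real
      by (auto intro!: ac_primitive_C1 derivative_eq_intros)
    have up: "P y - P 0 - (c * y + \<bar>c\<bar> / 4 * y) \<le> C" if "0 \<le> y" for y
    proof -
      have "(P y - (c * y + \<bar>c\<bar> / 4 * y)) - (P 0 - (c * 0 + \<bar>c\<bar> / 4 * 0)) \<le> C"
        unfolding C_def
      proof (rule ac_primitive_le_integral[OF iC _ ac_primitive_diff[OF P ac_primitive_add[OF lin lin]] that])
        show "AE x in lebesgue. x \<in> {0..y} \<longrightarrow> z x + c - (c + \<bar>c\<bar> / 4) \<le> (z x)\<^sup>2 / \<bar>c\<bar>"
        proof (intro AE_I2 impI)
          fix x show "z x + c - (c + \<bar>c\<bar> / 4) \<le> (z x)\<^sup>2 / \<bar>c\<bar>"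
            using zc[of x] abs_ge_self[of "z x"] by linarith
        qed
      qed simp
      then show ?thesis by simp
    qed
    have dn: "- P y + P 0 - (- c * y + \<bar>c\<bar> / 4 * y) \<le> C" if "0 \<le> y" for y
    proof -
      have "(- P y - (- c * y + \<bar>c\<bar> / 4 * y)) - (- P 0 - (- c * 0 + \<bar>c\<bar> / 4 * 0)) \<le> C"
        unfolding C_def
      proof (rule ac_primitive_le_integral[OF iC _
            ac_primitive_diff[OF ac_primitive_uminus[OF P] ac_primitive_add[OF lin lin]] that])
        show "AE x in lebesgue. x \<in> {0..y} \<longrightarrow> - (z x + c) - (- c + \<bar>c\<bar> / 4) \<le> (z x)\<^sup>2 / \<bar>c\<bar>"
        proof (intro AE_I2 impI)
          fix x show "- (z x + c) - (- c + \<bar>c\<bar> / 4) \<le> (z x)\<^sup>2 / \<bar>c\<bar>"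
            using zc[of x] abs_ge_minus_self[of "z x"] by linarith
        qed
      qed simp
      then show ?thesis by simp
    qed
    define Y where "Y = max 1 ((\<bar>P 0\<bar> + C) * 4 / \<bar>c\<bar>)"
    have low: "\<bar>c\<bar> / 2 \<le> \<bar>G y\<bar> + \<bar>z y\<bar>" if "Y \<le> y" for y
    proof -
      have y: "1 \<le> y" "(\<bar>P 0\<bar> + C) * 4 / \<bar>c\<bar> \<le> y" using that by (auto simp: Y_def)
      then have y': "\<bar>P 0\<bar> + C \<le> \<bar>c\<bar> * y / 4" using c by (simp add: field_simps)
      have "\<bar>c\<bar> * y = \<bar>c * y\<bar>" using y by (simp add: abs_mult)
      then have "\<bar>c\<bar> * y / 2 \<le> \<bar>P y\<bar>"
        using up[of y] dn[of y] y y' by (simp add: abs_if split: if_splits)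
      also have "\<dots> \<le> \<bar>G y\<bar> + y / 2 * \<bar>z y\<bar>"
        using y abs_triangle_ineq[of "G y" "y / 2 * z y"] by (simp add: P_def abs_mult)
      also have "\<dots> \<le> y * (\<bar>G y\<bar> + \<bar>z y\<bar>)"
      proof -
        have "1 * \<bar>G y\<bar> \<le> y * \<bar>G y\<bar>" using y by (intro mult_right_mono) auto
        moreover have "y / 2 * \<bar>z y\<bar> \<le> y * \<bar>z y\<bar>" using y by (intro mult_right_mono) auto
        ultimately show ?thesis by (simp add: algebra_simps)
      qed
      finally have "y * (\<bar>c\<bar> / 2) \<le> y * (\<bar>G y\<bar> + \<bar>z y\<bar>)" by (simp add: algebra_simps)
      then show ?thesis using y by (simp only: mult_le_cancel_left_pos)
    qed
    have "(\<bar>c\<bar> / 2)\<^sup>2 \<le> f y" if "Y \<le> y" for y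
    proof -
      have "(\<bar>c\<bar> / 2)\<^sup>2 \<le> (\<bar>G y\<bar> + \<bar>z y\<bar>)\<^sup>2" using low[OF that] by (intro power_mono) auto
      also have "\<dots> \<le> f y"
      proof -
        have "0 \<le> (\<bar>G y\<bar> - \<bar>z y\<bar>)\<^sup>2" by simp
        then show ?thesis by (simp add: f_def power2_eq_square algebra_simps)
      qed
      finally show ?thesis .
    qed
    then have "AE y in lebesgue. Y \<le> y \<longrightarrow> (\<bar>c\<bar> / 2)\<^sup>2 \<le> f y" by simp
    then show False using integrable_not_bounded_below_right[OF f, of "(\<bar>c\<bar> / 2)\<^sup>2" Y] c by simp
  qed
  \<comment> \<open>\<open>Q\<close> is nondecreasing; a nonzero value would persist up to one end of the line and
      make \<open>f\<close> exceed a multiple of \<open>1 / \<bar>y\<bar>\<close> there.\<close>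
  define Q where "Q y = z y * G y + y / 4 * (z y * z y)" for y
  have Q: "ac_primitive UNIV Q (\<lambda>y. w y * G y + 3 / 4 * (z y * z y))"
  proof -
    have e: "(\<lambda>y. (w y * G y + z y * (\<Phi> y - y / 2 * w y)) + (1 / 4 * (z y * z y) + y / 4 * (w y * z y + z y * w y)))
      = (\<lambda>y. w y * G y + 3 / 4 * (z y * z y))"
      by (auto simp: fun_eq_iff \<Phi>z c0 algebra_simps)
    show ?thesis
      using ac_primitive_add[OF ac_primitive_mult[OF z G] ac_primitive_mult[OF half[of 4] ac_primitive_mult[OF z z]]]
      unfolding e by (simp add: Q_def[abs_def])
  qed
  have Q_mono: "Q a \<le> Q b" if "a \<le> b" for a b
  proof -
    have "ac_primitive UNIV (\<lambda>_. 0) (\<lambda>_. 0)" by (rule ac_primitive_C1) auto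
    moreover have "AE y in lebesgue. y \<in> {a..b} \<longrightarrow> 0 \<le> w y * G y + 3 / 4 * (z y * z y)"
      using Gw by eventually_elim simp
    ultimately show ?thesis using ac_primitive_mono_AE[OF _ Q that] by fastforce
  qed
  have zG: "\<bar>z y * G y\<bar> \<le> f y / 2" for y using square_bound[of "z y" "G y"] by (simp add: f_def)
  have z4: "z y * z y \<le> f y / 2" for y by (simp add: f_def power2_eq_square)
  have Q0: "Q a = 0" for a
  proof (rule ccontr)
    assume "Q a \<noteq> 0"
    then consider "Q a > 0" | "Q a < 0" by linarith
    then show False
    proof cases
      case 1
      have "Q a \<le> \<bar>y\<bar> * f y" if "max a 1 \<le> y" for y
      proof -
        have "Q a \<le> Q y" using Q_mono that by simp
        also have "\<dots> \<le> 1 * (f y / 2) + y / 4 * (f y / 2)"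
          unfolding Q_def using zG[of y] that by (intro add_mono mult_left_mono z4) auto
        also have "\<dots> \<le> y * (f y / 2) + y * (f y / 2)"
          using that z4[of y] by (intro add_mono mult_right_mono) (auto simp: f_def)
        finally show ?thesis using that by simp
      qed
      then show False using integrable_not_ge_inverse_right[OF f 1, of "max a 1"] by simp
    next
      case 2
      have "- Q a \<le> \<bar>y\<bar> * f y" if "y \<le> min a (- 1)" for y
      proof -
        have "- Q a \<le> - Q y" using Q_mono that by simp
        also have "\<dots> = - (z y * G y) + (- y) / 4 * (z y * z y)" by (simp add: Q_def)
        also have "\<dots> \<le> 1 * (f y / 2) + (- y) / 4 * (f y / 2)"
          using zG[of y] that by (intro add_mono mult_left_mono z4) auto
        also have "\<dots> \<le> (- y) * (f y / 2) + (- y) * (f y / 2)"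
          using that z4[of y] by (intro add_mono mult_right_mono) (auto simp: f_def)
        finally show ?thesis using that by simp
      qed
      then show False using integrable_not_ge_inverse_left[OF f, of "- Q a" "min a (- 1)"] 2 by simp
    qed
  qed
  have "AE y in lebesgue. w y * G y + 3 / 4 * (z y * z y) = 0"
    by (rule ac_primitive_constant_imp_AE_zero[OF Q]) (simp add: Q0)
  with Gw have "AE y in lebesgue. z y = 0"
  proof eventually_elim
    case (elim y) then show ?case using zero_le_square[of "z y"] by (simp add: add_nonneg_eq_0_iff)
  qed
  then have "z y = 0" for y using continuous_AE_eq_const[OF ac_primitive_continuous[OF z]] by blast
  then have "AE y in lebesgue. w y = 0" by (intro ac_primitive_constant_imp_AE_zero[OF z]) simp
  then show ?thesis by eventually_elim (simp add: w_def)
qed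

section \<open>Monotonicity of the primitive along a profile\<close>

lemma open_real_near:
  fixes x :: real
  assumes "open {s. P s}" "P x"
  shows "\<exists>d>0. \<forall>s. \<bar>s - x\<bar> < d \<longrightarrow> P s"
  using assms by (simp add: open_dist dist_real_def)

lemma last_crossing:
  fixes W :: "real \<Rightarrow> real"
  assumes c: "continuous_on UNIV W" and x: "x0 < x" "W x0 \<le> \<kappa>" "\<kappa> < W x"
  shows "\<exists>a. x0 \<le> a \<and> a < x \<and> W a = \<kappa> \<and> (\<forall>s. a < s \<and> s \<le> x \<longrightarrow> \<kappa> < W s)"
proof -
  define S where "S = {x0..x} \<inter> {t. W t \<le> \<kappa>}"
  have "closed {t. W t \<le> \<kappa>}" using c by (intro closed_Collect_le) (auto intro: continuous_intros)
  then have "compact S" unfolding S_def by (intro compact_Int_closed) auto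
  moreover have "x0 \<in> S" using x by (simp add: S_def)
  then have "S \<noteq> {}" by blast
  ultimately obtain a where a: "a \<in> S" "\<And>t. t \<in> S \<Longrightarrow> t \<le> a" using compact_attains_sup[of S] by auto
  have above: "\<kappa> < W s" if "a < s" "s \<le> x" for s
    using a(2)[of s] a(1) that unfolding S_def by force
  have ax: "a < x" using a(1) x unfolding S_def by (cases "a = x") auto
  have "W a = \<kappa>"
  proof (rule ccontr)
    assume "W a \<noteq> \<kappa>"
    then have "W a < \<kappa>" using a(1) by (simp add: S_def)
    then obtain t where "a \<le> t" "t \<le> x" "W t = \<kappa>"
      using IVT'[of W a \<kappa> x] ax x continuous_on_subset[OF c] by auto
    then show False using above[of t] \<open>W a < \<kappa>\<close> by (cases "t = a") auto
  qed
  then show ?thesis using a(1) ax above by (intro exI[of _ a]) (auto simp: S_def)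
qed

lemma first_crossing:
  fixes W :: "real \<Rightarrow> real"
  assumes c: "continuous_on UNIV W" and x: "x < y0" "W y0 \<le> \<kappa>" "\<kappa> < W x"
  shows "\<exists>b. x < b \<and> b \<le> y0 \<and> W b = \<kappa> \<and> (\<forall>s. x \<le> s \<and> s < b \<longrightarrow> \<kappa> < W s)"
proof -
  have "continuous_on UNIV (\<lambda>t. W (- t))"
    by (rule continuous_on_compose2[OF c]) (auto intro: continuous_intros)
  from last_crossing[OF this, of "- y0" "- x" \<kappa>] x
  obtain a where a: "- y0 \<le> a" "a < - x" "W (- a) = \<kappa>" "\<forall>s. a < s \<and> s \<le> - x \<longrightarrow> \<kappa> < W (- s)"
    by auto
  have "\<kappa> < W s" if "x \<le> s" "s < - a" for s using spec[OF a(4), of "- s"] that by auto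
  then show ?thesis using a by (intro exI[of _ "- a"]) auto
qed

text \<open>
  With \<open>H = F - s k / 2\<close> the hypotheses say \<open>W' = H\<close> at both ends and \<open>H' = (U - k) / 2 > 0\<close> in between. A
  function above its boundary values has \<open>W' a \<ge> 0 \<ge> W' b\<close>, which is incompatible with \<open>H a < H b\<close>.
\<close>

lemma no_hump:
  assumes W: "ac_primitive UNIV W (\<lambda>s. F s - s / 2 * U s)" and F: "ac_primitive UNIV F (\<lambda>s. U s / 2)"
    and ab: "a < b" "W a = \<kappa>" "W b = \<kappa>" "\<And>s. a < s \<Longrightarrow> s < b \<Longrightarrow> \<kappa> < W s"
    and Da: "(W has_real_derivative F a - a / 2 * k) (at a)"
    and Db: "(W has_real_derivative F b - b / 2 * k) (at b)"
    and U: "AE s in lebesgue. a < s \<and> s < b \<longrightarrow> k < U s"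
  shows False
proof -
  define H where "H s = F s - s / 2 * k" for s
  have H: "ac_primitive UNIV H (\<lambda>s. U s / 2 - k / 2)"
  proof -
    have "ac_primitive UNIV (\<lambda>s. s / 2 * k) (\<lambda>s. k / 2)"
      by (rule ac_primitive_C1) (auto intro!: derivative_eq_intros)
    from ac_primitive_diff[OF F this] show ?thesis by (simp add: H_def[abs_def])
  qed
  have Ha: "0 \<le> H a"
  proof (rule ccontr)
    assume "\<not> 0 \<le> H a"
    then obtain d where d: "d > 0" "\<And>h. 0 < h \<Longrightarrow> h < d \<Longrightarrow> W (a + h) < W a"
      using DERIV_neg_dec_right[OF Da] by (auto simp: H_def)
    define h where "h = min (d / 2) ((b - a) / 2)"
    have "0 < h" "h < d" "a + h < b" using d(1) ab(1) by (auto simp: h_def min_def field_simps)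
    then show False using d(2)[of h] ab(4)[of "a + h"] ab(2) by auto
  qed
  have Hb: "H b \<le> 0"
  proof (rule ccontr)
    assume "\<not> H b \<le> 0"
    then obtain d where d: "d > 0" "\<And>h. 0 < h \<Longrightarrow> h < d \<Longrightarrow> W (b - h) < W b"
      using DERIV_pos_inc_left[OF Db] by (auto simp: H_def)
    define h where "h = min (d / 2) ((b - a) / 2)"
    have "0 < h" "h < d" "a < b - h" using d(1) ab(1) by (auto simp: h_def min_def field_simps)
    then show False using d(2)[of h] ab(4)[of "b - h"] ab(3) by auto
  qed
  have mono: "H c \<le> H d" if "a \<le> c" "c \<le> d" "d \<le> b" for c d
  proof -
    have Z: "ac_primitive UNIV (\<lambda>_. 0) (\<lambda>_. 0)" by (rule ac_primitive_C1) auto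
    have ends: "AE s in lebesgue. s \<noteq> a \<and> s \<noteq> b"
      by (intro AE_conjI AE_completion AE_lborel_singleton)
    have "AE s in lebesgue. s \<in> {c..d} \<longrightarrow> 0 \<le> U s / 2 - k / 2"
      using U ends by eventually_elim (use that in auto)
    from ac_primitive_mono_AE[OF Z H that(2) _ this] show ?thesis by simp
  qed
  have H0: "H c = 0" if "c \<in> {a..b}" for c
  proof -
    have "H a \<le> H c" "H c \<le> H b" using that by (auto intro: mono)
    then show ?thesis using Ha Hb by linarith
  qed
  have "AE s in lebesgue. s \<in> {a..b} \<longrightarrow> U s / 2 - k / 2 = 0"
  proof (rule AE_zero_if_zero_integrals)
    show "set_integrable lebesgue {a..b} (\<lambda>s. U s / 2 - k / 2)"
      using ac_primitive_locally_integrable[OF H] by (simp add: locally_integrable_def)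
    show "(LINT s:{c..d}|lebesgue. U s / 2 - k / 2) = 0" if "a \<le> c" "c \<le> d" "d \<le> b" for c d
      using ac_primitive_integral[OF H that(2)] H0[of c] H0[of d] that by simp
  qed
  with U have "AE s in lebesgue. \<not> (a < s \<and> s < b)" by eventually_elim auto
  from AE_lebesgue_ex[OF this ab(1)] show False by auto
qed

text \<open>
  At a regular level \<open>k\<close>, the only value that \<open>A\<close> maps to \<open>A k\<close>, closeness of \<open>A(U)\<close> to \<open>A k\<close> forces closeness
  of \<open>U\<close> to \<open>k\<close>. So the almost everywhere derivative \<open>F - s U / 2\<close> of \<open>W\<close> has a limit at \<open>p\<close>, although
  \<open>U\<close> may jump elsewhere.
\<close>

lemma derivative_at_regular_level:
  assumes W: "ac_primitive UNIV W (\<lambda>s. F s - s / 2 * U s)" and F: "ac_primitive UNIV F (\<lambda>s. U s / 2)"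
    and AU: "AE s in lebesgue. A (U s) = W s" and A: "mono A"
    and reg: "\<And>\<eta>. 0 < \<eta> \<Longrightarrow> A (k - \<eta>) < A k \<and> A k < A (k + \<eta>)" and p: "W p = A k"
  shows "(W has_real_derivative F p - p / 2 * k) (at p)"
proof -
  define L where "L = F p - p / 2 * k"
  have "\<exists>d>0. \<forall>y. \<bar>y - p\<bar> < d \<longrightarrow> \<bar>W y - W p - L * (y - p)\<bar> \<le> e * \<bar>y - p\<bar>" if e: "0 < e" for e
  proof -
    define \<eta> where "\<eta> = e / (\<bar>p\<bar> + 1)"
    have \<eta>: "0 < \<eta>" using e by (simp add: \<eta>_def)
    have "open {s. A (k - \<eta>) < W s \<and> W s < A (k + \<eta>) \<and> \<bar>(F s - s / 2 * k) - L\<bar> < e / 2}"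
      by (intro open_Collect_conj open_Collect_less continuous_intros
          ac_primitive_continuous[OF W] ac_primitive_continuous[OF F]) auto
    from open_real_near[OF this] have "\<exists>d>0. \<forall>s. \<bar>s - p\<bar> < d \<longrightarrow>
        A (k - \<eta>) < W s \<and> W s < A (k + \<eta>) \<and> \<bar>(F s - s / 2 * k) - L\<bar> < e / 2"
      if "A (k - \<eta>) < W p \<and> W p < A (k + \<eta>) \<and> \<bar>(F p - p / 2 * k) - L\<bar> < e / 2"
      using that by blast
    moreover have "A (k - \<eta>) < W p \<and> W p < A (k + \<eta>) \<and> \<bar>(F p - p / 2 * k) - L\<bar> < e / 2"
      using reg[OF \<eta>] p e by (simp add: L_def)
    ultimately obtain d0 where d0: "d0 > 0" and near: "\<And>s. \<bar>s - p\<bar> < d0 \<Longrightarrow>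
        A (k - \<eta>) < W s \<and> W s < A (k + \<eta>) \<and> \<bar>(F s - s / 2 * k) - L\<bar> < e / 2"
      by blast
    define d where "d = min d0 1"
    have g: "AE s in lebesgue. \<bar>s - p\<bar> < d \<longrightarrow> L - e \<le> F s - s / 2 * U s \<and> F s - s / 2 * U s \<le> L + e"
      using AU
    proof (eventually_elim, intro impI)
      fix s assume AUs: "A (U s) = W s" and s: "\<bar>s - p\<bar> < d"
      have s': "\<bar>s - p\<bar> < d0" "\<bar>s\<bar> \<le> \<bar>p\<bar> + 1" using s by (auto simp: d_def)
      have "U s < k + \<eta>" using near[OF s'(1)] monoD[OF A, of "k + \<eta>" "U s"] AUs by (intro not_le_imp_less) auto
      moreover have "k - \<eta> < U s" using near[OF s'(1)] monoD[OF A, of "U s" "k - \<eta>"] AUs by (intro not_le_imp_less) auto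
      ultimately have "\<bar>U s - k\<bar> \<le> \<eta>" by auto
      then have "\<bar>s\<bar> * \<bar>U s - k\<bar> \<le> (\<bar>p\<bar> + 1) * \<eta>" using s'(2) by (intro mult_mono) auto
      then have "\<bar>s * (U s - k)\<bar> \<le> e" by (simp add: \<eta>_def abs_mult)
      moreover have "F s - s / 2 * U s - L = (F s - s / 2 * k) - L - s * (U s - k) / 2"
        by (simp add: diff_divide_distrib right_diff_distrib)
      ultimately show "L - e \<le> F s - s / 2 * U s \<and> F s - s / 2 * U s \<le> L + e"
        using near[OF s'(1)] by linarith
    qed
    have lin: "ac_primitive UNIV (\<lambda>s. c * s) (\<lambda>s. c)" for c :: real
      by (rule ac_primitive_C1) (auto intro!: derivative_eq_intros)
    have bounds: "(L - e) * (y - x) \<le> W y - W x \<and> W y - W x \<le> (L + e) * (y - x)"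
      if "x \<le> y" "\<bar>x - p\<bar> < d" "\<bar>y - p\<bar> < d" for x y
    proof
      have "AE s in lebesgue. s \<in> {x..y} \<longrightarrow> L - e \<le> F s - s / 2 * U s"
        using g by eventually_elim (use that in auto)
      from ac_primitive_mono_AE[OF lin W that(1) _ this]
      show "(L - e) * (y - x) \<le> W y - W x" by (simp add: algebra_simps)
      have "AE s in lebesgue. s \<in> {x..y} \<longrightarrow> F s - s / 2 * U s \<le> L + e"
        using g by eventually_elim (use that in auto)
      from ac_primitive_mono_AE[OF W lin that(1) _ this]
      show "W y - W x \<le> (L + e) * (y - x)" by (simp add: algebra_simps)
    qed
    have "\<bar>W y - W p - L * (y - p)\<bar> \<le> e * \<bar>y - p\<bar>" if "\<bar>y - p\<bar> < d" for y
    proof (cases "p \<le> y")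
      case True
      then show ?thesis using bounds[of p y] that by (auto simp: algebra_simps)
    next
      case False
      then show ?thesis using bounds[of y p] that by (auto simp: algebra_simps)
    qed
    moreover have "d > 0" using d0 by (simp add: d_def)
    ultimately show ?thesis by blast
  qed
  then show ?thesis
    unfolding has_field_derivative_def has_derivative_at_alt L_def[symmetric]
    by (auto simp: bounded_linear_mult_right)
qed

text \<open>
  The boundary values are attained in this weak sense because \<open>U - U\<^sub>\<plusminus>\<close> is square integrable near \<open>\<plusminus>\<infinity>\<close>.
\<close>

lemma
  assumes U: "stationary_profile D Um Up U" and \<delta>: "\<delta> > 0"
  shows profile_right_limit: "\<not> (AE y in lebesgue. a \<le> y \<longrightarrow> \<delta> \<le> \<bar>U y - Up\<bar>)"
    and profile_left_limit: "\<not> (AE y in lebesgue. y \<le> a \<longrightarrow> \<delta> \<le> \<bar>U y - Um\<bar>)"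
proof -
  obtain v w where v: "H1_deriv v w" "AE y in lebesgue. U y = ubar Um Up y + w y"
    using U by (auto simp: stationary_profile_def)
  have w: "integrable lebesgue (\<lambda>y. (w y)\<^sup>2)" "AE y in lebesgue. 0 \<le> (w y)\<^sup>2"
    using v(1) by (auto simp: H1_deriv_def L2_UNIV_iff)
  have \<delta>2: "\<delta>\<^sup>2 > 0" using \<delta> by simp
  show "\<not> (AE y in lebesgue. a \<le> y \<longrightarrow> \<delta> \<le> \<bar>U y - Up\<bar>)"
  proof
    assume "AE y in lebesgue. a \<le> y \<longrightarrow> \<delta> \<le> \<bar>U y - Up\<bar>"
    with v(2) have "AE y in lebesgue. max a 0 \<le> y \<longrightarrow> \<delta>\<^sup>2 \<le> (w y)\<^sup>2"
    proof eventually_elim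
      case (elim y)
      then show ?case using \<delta> by (auto simp: ubar_def abs_le_square_iff[symmetric])
    qed
    then show False using integrable_not_bounded_below_right[OF w \<delta>2] by blast
  qed
  show "\<not> (AE y in lebesgue. y \<le> a \<longrightarrow> \<delta> \<le> \<bar>U y - Um\<bar>)"
  proof
    assume "AE y in lebesgue. y \<le> a \<longrightarrow> \<delta> \<le> \<bar>U y - Um\<bar>"
    with v(2) have "AE y in lebesgue. y \<le> min a (-1) \<longrightarrow> \<delta>\<^sup>2 \<le> (w y)\<^sup>2"
    proof eventually_elim
      case (elim y)
      then show ?case using \<delta> by (auto simp: ubar_def abs_le_square_iff[symmetric])
    qed
    then show False using integrable_not_bounded_below_left[OF w \<delta>2] by blast
  qed
qed

text \<open>
  A descent of \<open>W\<close> crosses a regular level \<open>\<kappa> = A k\<close>, being above it at \<open>x\<close> and below it at a later \<open>y\<close>. If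
  \<open>k > U\<^sub>-\<close>, then \<open>W\<close> must be at or below \<open>\<kappa>\<close> somewhere to the left of \<open>x\<close>, which closes a hump around \<open>x\<close>;
  otherwise \<open>k < U\<^sub>+\<close>, and \<open>W\<close> must be at or above \<open>\<kappa>\<close> somewhere to the right of \<open>y\<close>, which closes a dip
  around \<open>y\<close>, that is, a hump of \<open>-W\<close>.
\<close>

lemma flux_form_mono:
  assumes less: "Um < Up" and D: "admissible D" and U: "stationary_profile D Um Up U"
    and flux: "flux_form (primitive D) U W F"
  shows "mono W"
proof (rule monoI, rule ccontr)
  let ?A = "primitive D"
  note AU = flux_form_AE[OF flux] and W = flux_form_W[OF flux] and F = flux_form_F[OF flux]
  note A = primitive_mono[OF D] and Wc = ac_primitive_continuous[OF W]
  fix x0 y0 :: real assume "x0 \<le> y0" and "\<not> W x0 \<le> W y0"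
  then have xy0: "x0 < y0" "W y0 < W x0" by (cases "x0 = y0"; force)+
  define m where "m = (W x0 + W y0) / 2"
  have m: "W y0 < m" "m < W x0" using xy0 by (auto simp: m_def)
  have "open {s. m < W s}" "open {s. W s < m}"
    by (intro open_Collect_less continuous_intros Wc)+
  then obtain e1 e2 where e: "e1 > 0" "\<And>s. \<bar>s - x0\<bar> < e1 \<Longrightarrow> m < W s"
      "e2 > 0" "\<And>s. \<bar>s - y0\<bar> < e2 \<Longrightarrow> W s < m"
    using open_real_near[of "\<lambda>s. m < W s" x0] open_real_near[of "\<lambda>s. W s < m" y0] m by blast
  define h where "h = (y0 - x0) / 2"
  have h: "h > 0" "x0 + h = y0 - h" using xy0 by (auto simp: h_def field_simps)
  obtain x where x: "x0 < x" "x < x0 + min e1 h" "?A (U x) = W x"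
    using AE_lebesgue_ex[OF AU, of x0 "x0 + min e1 h"] e h by auto
  obtain y where y: "y0 - min e2 h < y" "y < y0" "?A (U y) = W y"
    using AE_lebesgue_ex[OF AU, of "y0 - min e2 h" y0] e h by auto
  have xy: "x < y" using x y h by auto
  have "m < W x" "W y < m" using e(2)[of x] e(4)[of y] x y by auto
  then have AUxy: "?A (U y) < ?A (U x)" using x y by simp
  then have Uxy: "U y < U x" using monoD[OF A, of "U x" "U y"] by (intro not_le_imp_less) auto
  \<comment> \<open>A regular level between the two values: any \<open>k\<close> with \<open>D k > 0\<close> is one.\<close>
  obtain k where k: "U y < k" "k < U x" "?A (U x) - ?A (U y) = (U x - U y) * D k"
    using MVT2[OF Uxy primitive_deriv[OF D]] by blast
  have "0 < (U x - U y) * D k" using k(3) AUxy by simp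
  then have Dk: "D k > 0" using Uxy by (simp add: zero_less_mult_iff)
  have reg: "?A (k - \<eta>) < ?A k \<and> ?A k < ?A (k + \<eta>)" if \<eta>: "0 < \<eta>" for \<eta>
  proof
    obtain d where d: "d > 0" "\<And>h. 0 < h \<Longrightarrow> h < d \<Longrightarrow> ?A k < ?A (k + h)"
      using DERIV_pos_inc_right[OF primitive_deriv[OF D] Dk] by blast
    have "?A k < ?A (k + min \<eta> (d / 2))" using d \<eta> by (intro d(2)) (auto simp: min_def)
    also have "\<dots> \<le> ?A (k + \<eta>)" by (rule monoD[OF A]) simp
    finally show "?A k < ?A (k + \<eta>)" .
    obtain d where d: "d > 0" "\<And>h. 0 < h \<Longrightarrow> h < d \<Longrightarrow> ?A (k - h) < ?A k"
      using DERIV_pos_inc_left[OF primitive_deriv[OF D] Dk] by blast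
    have "?A (k - \<eta>) \<le> ?A (k - min \<eta> (d / 2))" by (rule monoD[OF A]) simp
    also have "\<dots> < ?A k" using d \<eta> by (intro d(2)) (auto simp: min_def)
    finally show "?A (k - \<eta>) < ?A k" .
  qed
  define \<kappa> where "\<kappa> = ?A k"
  have Wxy: "W y < \<kappa>" "\<kappa> < W x"
    using reg[of "k - U y"] reg[of "U x - k"] k x y by (auto simp: \<kappa>_def)
  have deriv: "(W has_real_derivative F p - p / 2 * k) (at p)" if "W p = \<kappa>" for p
    by (rule derivative_at_regular_level[OF W F AU A reg]) (use that in \<open>auto simp: \<kappa>_def\<close>)
  have above: "k < U s" if "?A (U s) = W s" "\<kappa> < W s" for s
    using that monoD[OF A, of "U s" k] by (intro not_le_imp_less) (auto simp: \<kappa>_def)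
  have below: "U s < k" if "?A (U s) = W s" "W s < \<kappa>" for s
    using that monoD[OF A, of k "U s"] by (intro not_le_imp_less) (auto simp: \<kappa>_def)
  show False
  proof (cases "Um < k")
    case True
    have "\<exists>t<x. W t \<le> \<kappa>"
    proof (rule ccontr)
      assume "\<not> ?thesis"
      then have t: "\<And>t. t < x \<Longrightarrow> \<kappa> < W t" by force
      have "AE s in lebesgue. s \<le> x - 1 \<longrightarrow> k - Um \<le> \<bar>U s - Um\<bar>"
        using AU
      proof eventually_elim
        case (elim s) then show ?case using t[of s] above[of s] by auto
      qed
      then show False using profile_left_limit[OF U, of "k - Um" "x - 1"] True by simp
    qed
    then obtain t where t: "t < x" "W t \<le> \<kappa>" by blast
    obtain a where a: "a < x" "W a = \<kappa>" "\<forall>s. a < s \<and> s \<le> x \<longrightarrow> \<kappa> < W s"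
      using last_crossing[OF Wc t Wxy(2)] by blast
    obtain b where b: "x < b" "W b = \<kappa>" "\<forall>s. x \<le> s \<and> s < b \<longrightarrow> \<kappa> < W s"
      using first_crossing[OF Wc xy less_imp_le[OF Wxy(1)] Wxy(2)] by blast
    have ab: "\<kappa> < W s" if "a < s" "s < b" for s
      using a(3) b(3) that by (cases "s \<le> x") auto
    show False
    proof (rule no_hump[OF W F _ a(2) b(2) ab deriv[OF a(2)] deriv[OF b(2)]])
      show "AE s in lebesgue. a < s \<and> s < b \<longrightarrow> k < U s"
        using AU by eventually_elim (use ab above in blast)
    qed (use a b in auto)
  next
    case False
    then have "k < Up" using less by simp
    have "\<exists>t>y. \<kappa> \<le> W t"
    proof (rule ccontr)
      assume "\<not> ?thesis"
      then have t: "\<And>t. y < t \<Longrightarrow> W t < \<kappa>" by force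
      have "AE s in lebesgue. y + 1 \<le> s \<longrightarrow> Up - k \<le> \<bar>U s - Up\<bar>"
        using AU
      proof eventually_elim
        case (elim s) then show ?case using t[of s] below[of s] by auto
      qed
      then show False using profile_right_limit[OF U, of "Up - k" "y + 1"] \<open>k < Up\<close> by simp
    qed
    then obtain t where t: "y < t" "\<kappa> \<le> W t" by blast
    have mWc: "continuous_on UNIV (\<lambda>s. - W s)" by (intro continuous_intros Wc)
    obtain b where b: "y < b" "- W b = - \<kappa>" "\<forall>s. y \<le> s \<and> s < b \<longrightarrow> - \<kappa> < - W s"
    proof -
      have "- W t \<le> - \<kappa>" "- \<kappa> < - W y" using t(2) Wxy(1) by auto
      from first_crossing[OF mWc t(1) this] show ?thesis using that by blast
    qed
    obtain a where a: "a < y" "- W a = - \<kappa>" "\<forall>s. a < s \<and> s \<le> y \<longrightarrow> - \<kappa> < - W s"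
    proof -
      have "- W x \<le> - \<kappa>" "- \<kappa> < - W y" using Wxy by auto
      from last_crossing[OF mWc xy this] show ?thesis using that by blast
    qed
    have ab: "- \<kappa> < - W s" if "a < s" "s < b" for s
      using a(3) b(3) that by (cases "s \<le> y") auto
    have W': "ac_primitive UNIV (\<lambda>s. - W s) (\<lambda>s. - F s - s / 2 * - U s)"
      using ac_primitive_uminus[OF W] by (simp add: algebra_simps)
    have F': "ac_primitive UNIV (\<lambda>s. - F s) (\<lambda>s. - U s / 2)"
      using ac_primitive_uminus[OF F] by simp
    have deriv': "((\<lambda>s. - W s) has_real_derivative - F p - p / 2 * - k) (at p)" if "- W p = - \<kappa>" for p
      using DERIV_minus[OF deriv[of p]] that by (simp add: algebra_simps)
    show False
    proof (rule no_hump[OF W' F' _ a(2) b(2) ab deriv'[OF a(2)] deriv'[OF b(2)]])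
      show "AE s in lebesgue. a < s \<and> s < b \<longrightarrow> - k < - U s"
        using AU
      proof eventually_elim
        case (elim s) then show ?case using ab[of s] below[of s] by auto
      qed
    qed (use a b in auto)
  qed
qed

section \<open>Plateaus and jumps\<close>

text \<open>
  By monotonicity the level sets of \<open>W\<close> are intervals, and on each of them \<open>W' = F - s U / 2\<close> has zero
  integral over every subinterval.
\<close>

lemma plateau_flux:
  assumes W: "ac_primitive UNIV W (\<lambda>s. F s - s / 2 * U s)" and mono: "mono W"
  shows "AE s in lebesgue. W s = \<kappa> \<longrightarrow> F s = s / 2 * U s"
proof -
  have "AE s in lebesgue. s \<in> {- real n..real n} \<longrightarrow> (W s = \<kappa> \<longrightarrow> F s = s / 2 * U s)" for n
  proof -
    define S where "S = {- real n..real n} \<inter> {s. W s = \<kappa>}"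
    have "closed {s. W s = \<kappa>}"
      by (intro closed_Collect_eq ac_primitive_continuous[OF W] continuous_intros)
    then have "compact S" unfolding S_def by (intro compact_Int_closed) auto
    moreover have "is_interval S"
      unfolding is_interval_1
    proof (intro ballI allI impI)
      fix a b t assume "a \<in> S" "b \<in> S" "a \<le> t \<and> t \<le> b"
      then show "t \<in> S" using monoD[OF mono, of a t] monoD[OF mono, of t b] by (auto simp: S_def)
    qed
    ultimately obtain a b where S: "S = {a..b}" by (metis is_interval_compact cbox_interval)
    have "AE s in lebesgue. s \<in> {a..b} \<longrightarrow> F s - s / 2 * U s = 0"
    proof (rule AE_zero_if_zero_integrals)
      show "set_integrable lebesgue {a..b} (\<lambda>s. F s - s / 2 * U s)"
        using ac_primitive_locally_integrable[OF W] by (simp add: locally_integrable_def)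
      show "(LINT s:{c..d}|lebesgue. F s - s / 2 * U s) = 0" if "a \<le> c" "c \<le> d" "d \<le> b" for c d
      proof -
        have "c \<in> S" "d \<in> S" using that by (auto simp: S)
        then show ?thesis using ac_primitive_integral[OF W that(2)] by (simp add: S_def)
      qed
    qed
    then show ?thesis by eventually_elim (auto simp: S[symmetric] S_def)
  qed
  then show ?thesis by (rule AE_if_AE_on_Icc)
qed

text \<open>
  On a plateau \<open>F' = U / 2 = F / s\<close>. The right-hand side is continuous away from the origin, so \<open>F\<close> is
  continuously differentiable there and the derivative of \<open>F / s\<close> vanishes.
\<close>

lemma plateau_ratio:
  assumes W: "ac_primitive UNIV W (\<lambda>s. F s - s / 2 * U s)" and F: "ac_primitive UNIV F (\<lambda>s. U s / 2)"
    and mono: "mono W" and xy: "x \<le> y" "W x = W y" "0 \<notin> {x..y}"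
  shows "F x / x = F y / y"
proof -
  have flat: "W s = W x" if "s \<in> {x..y}" for s
    using monoD[OF mono, of x s] monoD[OF mono, of s y] that xy by auto
  have nz: "s \<noteq> 0" if "s \<in> {x..y}" for s using that xy(3) by blast
  have "AE s in lebesgue. s \<in> {x..y} \<longrightarrow> U s / 2 = F s / s"
    using plateau_flux[OF W mono, of "W x"]
  proof (eventually_elim, intro impI)
    fix s assume "W s = W x \<longrightarrow> F s = s / 2 * U s" and s: "s \<in> {x..y}"
    then have "F s = s / 2 * U s" using flat by blast
    then show "U s / 2 = F s / s" using nz[OF s] by simp
  qed
  then have F': "ac_primitive {x..y} F (\<lambda>s. F s / s)"
    by (rule ac_primitive_cong_AE[OF ac_primitive_subset[OF F subset_UNIV]])
  have c: "continuous_on {x..y} (\<lambda>s. F s / s)"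
    using nz by (intro continuous_intros ac_primitive_continuous[OF F]) auto
  have "((\<lambda>s. F s / s) has_real_derivative 0) (at s within {x..y})" if s: "s \<in> {x..y}" for s
    using ac_primitive_deriv_within[OF F' order_refl c s] nz[OF s]
    by (auto intro!: derivative_eq_intros)
  from has_field_derivative_zero_constant[OF _ this] obtain c where "\<And>s. s \<in> {x..y} \<Longrightarrow> F s / s = c"
    by (metis convex_real_interval(5))
  then show ?thesis using xy(1) by simp
qed

text \<open>
  The value of \<open>U\<close> on a plateau is \<open>cm = 2 F x / x\<close> on the left of the origin and \<open>cp = 2 F y / y\<close> on the
  right. Suppose \<open>cp < cm\<close>. If the plateau ends at \<open>b > 0\<close>, then \<open>F b = b cp / 2\<close> by continuity while \<open>U > cm\<close>
  beyond \<open>b\<close>, so \<open>W' = F - s U / 2 < 0\<close> just after \<open>b\<close> and \<open>W\<close> decreases. A left end is impossible for the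
  same reason. An infinite plateau must carry the boundary values, \<open>cm = U\<^sub>- < U\<^sub>+ = cp\<close>.
\<close>

lemma plateau_across_origin:
  assumes less: "Um < Up" and D: "admissible D" and U: "stationary_profile D Um Up U"
    and flux: "flux_form (primitive D) U W F" and xy: "x < 0" "0 < y" "W x = W y"
  shows "F x / x \<le> F y / y"
proof (rule ccontr)
  let ?A = "primitive D"
  note AU = flux_form_AE[OF flux] and W = flux_form_W[OF flux] and F = flux_form_F[OF flux]
  note A = primitive_mono[OF D] and Wc = ac_primitive_continuous[OF W] and Fc = ac_primitive_continuous[OF F]
  note mono = flux_form_mono[OF less D U flux]
  define \<kappa> where "\<kappa> = W x"
  define cm where "cm = 2 * F x / x"
  define cp where "cp = 2 * F y / y"
  assume "\<not> F x / x \<le> F y / y"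
  then have c: "cp < cm" by (simp add: cm_def cp_def)
  note flat = plateau_flux[OF W mono, of \<kappa>]
  have Fm: "F s = s / 2 * cm" if "s < 0" "W s = \<kappa>" for s
  proof -
    have "F s / s = F x / x"
    proof (cases "s \<le> x")
      case True
      show ?thesis by (rule plateau_ratio[OF W F mono True]) (use that xy in \<open>auto simp: \<kappa>_def\<close>)
    next
      case False
      then have "x \<le> s" by simp
      from plateau_ratio[OF W F mono this] show ?thesis using that xy by (auto simp: \<kappa>_def)
    qed
    moreover have "F s = s * (F s / s)" using that by simp
    ultimately show ?thesis by (simp add: cm_def)
  qed
  have Fp: "F s = s / 2 * cp" if "0 < s" "W s = \<kappa>" for s
  proof -
    have "F s / s = F y / y"
    proof (cases "s \<le> y")
      case True
      show ?thesis by (rule plateau_ratio[OF W F mono True]) (use that xy in \<open>auto simp: \<kappa>_def\<close>)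
    next
      case False
      then have "y \<le> s" by simp
      from plateau_ratio[OF W F mono this] show ?thesis using that xy by (auto simp: \<kappa>_def)
    qed
    moreover have "F s = s * (F s / s)" using that by simp
    ultimately show ?thesis by (simp add: cp_def)
  qed
  have mid: "W s = \<kappa>" if "x < s" "s < y" for s
    using monoD[OF mono, of x s] monoD[OF mono, of s y] that xy by (auto simp: \<kappa>_def)
  have Acm: "?A cm = \<kappa>"
  proof -
    obtain s where "x < s" "s < 0" "?A (U s) = W s \<and> (W s = \<kappa> \<longrightarrow> F s = s / 2 * U s)"
      using AE_lebesgue_ex[OF AE_conjI[OF AU flat] xy(1)] by blast
    then show ?thesis using mid[of s] Fm[of s] xy by auto
  qed
  have Acp: "?A cp = \<kappa>"
  proof -
    obtain s where "0 < s" "s < y" "?A (U s) = W s \<and> (W s = \<kappa> \<longrightarrow> F s = s / 2 * U s)"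
      using AE_lebesgue_ex[OF AE_conjI[OF AU flat] xy(2)] by blast
    then show ?thesis using mid[of s] Fp[of s] xy by auto
  qed
  have Z: "ac_primitive UNIV (\<lambda>_. 0) (\<lambda>_. 0)" by (rule ac_primitive_C1) auto
  have right: "W s = \<kappa>" if "y \<le> s" for s
  proof (rule ccontr)
    assume "W s \<noteq> \<kappa>"
    then have s: "\<kappa> < W s" "y < s" using monoD[OF mono that] xy that by (auto simp: \<kappa>_def order_less_le)
    obtain b where b: "y \<le> b" "b < s" "W b = \<kappa>" "\<And>t. b < t \<Longrightarrow> t \<le> s \<Longrightarrow> \<kappa> < W t"
      using last_crossing[OF Wc s(2) _ s(1)] xy(3) unfolding \<kappa>_def by auto
    have "open {t. F t - t / 2 * cm < 0}" by (intro open_Collect_less continuous_intros Fc) auto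
    moreover have "F b - b / 2 * cm < 0" using Fp[of b] b xy c by simp
    ultimately obtain d where d: "d > 0" "\<And>t. \<bar>t - b\<bar> < d \<Longrightarrow> F t - t / 2 * cm < 0"
      using open_real_near[of "\<lambda>t. F t - t / 2 * cm < 0" b] by blast
    define e where "e = min (d / 2) (s - b)"
    have e: "0 < e" "e < d" "b + e \<le> s" using d(1) b by (auto simp: e_def min_def)
    have "AE t in lebesgue. t \<noteq> b" by (intro AE_completion AE_lborel_singleton)
    with AU have "AE t in lebesgue. t \<in> {b..b + e} \<longrightarrow> F t - t / 2 * U t \<le> 0"
    proof (eventually_elim, intro impI)
      fix t assume t: "?A (U t) = W t" "t \<noteq> b" "t \<in> {b..b + e}"
      then have "\<kappa> < W t" using b(4)[of t] e by auto
      then have "cm \<le> U t" using monoD[OF A, of "U t" cm] t(1) Acm by (cases "cm \<le> U t") auto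
      then have "t / 2 * cm \<le> t / 2 * U t" using t b xy by (intro mult_left_mono) auto
      then show "F t - t / 2 * U t \<le> 0" using d(2)[of t] t e by auto
    qed
    from ac_primitive_mono_AE[OF W Z _ _ this] e have "W (b + e) \<le> W b" by simp
    then show False using b(3) b(4)[of "b + e"] e by auto
  qed
  have left: "W s = \<kappa>" if "s \<le> x" for s
  proof (rule ccontr)
    assume "W s \<noteq> \<kappa>"
    then have s: "W s < \<kappa>" "s < x" using monoD[OF mono that] xy that by (auto simp: \<kappa>_def order_less_le)
    have mWc: "continuous_on UNIV (\<lambda>s. - W s)" by (intro continuous_intros Wc)
    obtain b where b: "s < b" "b \<le> x" "- W b = - \<kappa>" "\<And>t. s \<le> t \<Longrightarrow> t < b \<Longrightarrow> - \<kappa> < - W t"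
      using first_crossing[OF mWc s(2), of "- \<kappa>"] s(1) unfolding \<kappa>_def by auto
    have "open {t. F t - t / 2 * cp < 0}" by (intro open_Collect_less continuous_intros Fc) auto
    moreover have "F b - b / 2 * cp < 0" using Fm[of b] b xy c by simp
    ultimately obtain d where d: "d > 0" "\<And>t. \<bar>t - b\<bar> < d \<Longrightarrow> F t - t / 2 * cp < 0"
      using open_real_near[of "\<lambda>t. F t - t / 2 * cp < 0" b] by blast
    define e where "e = min (d / 2) (b - s)"
    have e: "0 < e" "e < d" "s \<le> b - e" using d(1) b by (auto simp: e_def min_def)
    have "AE t in lebesgue. t \<noteq> b" by (intro AE_completion AE_lborel_singleton)
    with AU have "AE t in lebesgue. t \<in> {b - e..b} \<longrightarrow> F t - t / 2 * U t \<le> 0"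
    proof (eventually_elim, intro impI)
      fix t assume t: "?A (U t) = W t" "t \<noteq> b" "t \<in> {b - e..b}"
      then have "W t < \<kappa>" using b(4)[of t] e by auto
      then have "U t \<le> cp" using monoD[OF A, of cp "U t"] t(1) Acp by (cases "U t \<le> cp") auto
      then have "t / 2 * cp \<le> t / 2 * U t" using t b xy by (intro mult_left_mono_neg) auto
      then show "F t - t / 2 * U t \<le> 0" using d(2)[of t] t e by auto
    qed
    from ac_primitive_mono_AE[OF W Z _ _ this] e have "W b \<le> W (b - e)" by simp
    then show False using b(3) b(4)[of "b - e"] e by auto
  qed
  have "cp = Up"
  proof (rule ccontr)
    assume "cp \<noteq> Up"
    have "AE s in lebesgue. y \<le> s \<longrightarrow> \<bar>cp - Up\<bar> \<le> \<bar>U s - Up\<bar>"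
      using flat
    proof eventually_elim
      case (elim s) then show ?case using right[of s] Fp[of s] xy by auto
    qed
    then show False using profile_right_limit[OF U, of "\<bar>cp - Up\<bar>" y] \<open>cp \<noteq> Up\<close> by simp
  qed
  moreover have "cm = Um"
  proof (rule ccontr)
    assume "cm \<noteq> Um"
    have "AE s in lebesgue. s \<le> x \<longrightarrow> \<bar>cm - Um\<bar> \<le> \<bar>U s - Um\<bar>"
      using flat
    proof eventually_elim
      case (elim s) then show ?case using left[of s] Fm[of s] xy by auto
    qed
    then show False using profile_left_limit[OF U, of "\<bar>cm - Um\<bar>" x] \<open>cm \<noteq> Um\<close> by simp
  qed
  ultimately show False using c less by simp
qed

lemma ae_nondecreasingI:
  assumes P: "AE s in lebesgue. P s" and le: "\<And>x y. P x \<Longrightarrow> P y \<Longrightarrow> x < y \<Longrightarrow> U x \<le> U y"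
  shows "ae_nondecreasing U"
proof -
  define V where "V y = Sup (U ` {x. x \<le> y \<and> P x})" for y
  have ne: "U ` {x. x \<le> y \<and> P x} \<noteq> {}" for y
  proof -
    obtain x where "x < y" "P x" using AE_lebesgue_ex[OF P, of "y - 1" y] by auto
    then have "U x \<in> U ` {x. x \<le> y \<and> P x}" by simp
    then show ?thesis by blast
  qed
  have bdd: "bdd_above (U ` {x. x \<le> y \<and> P x})" for y
  proof -
    obtain z where "y < z" "P z" using AE_lebesgue_ex[OF P, of y "y + 1"] by auto
    then show ?thesis by (intro bdd_aboveI2[of _ _ "U z"] le) auto
  qed
  have "mono V"
    unfolding V_def by (intro monoI cSup_subset_mono ne bdd) auto
  moreover have "AE y in lebesgue. U y = V y"
    using P
  proof eventually_elim
    case (elim y)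
    have "x \<le> y \<and> P x \<Longrightarrow> U x \<le> U y" for x using le[of x y] elim by (cases "x = y") auto
    then show ?case
      unfolding V_def using elim by (intro cSup_eq_maximum[symmetric]) auto
  qed
  ultimately show ?thesis unfolding ae_nondecreasing_def by blast
qed

text \<open>
  The exceptional null set has to be chosen before the two points are compared. One null set for each
  rational point suffices, since a plateau of \<open>W\<close> containing two points contains a rational one.
\<close>

lemma stationary_profile_nondecreasing:
  assumes less: "Um < Up" and D: "admissible D" and U: "stationary_profile D Um Up U"
  shows "ae_nondecreasing U"
proof -
  let ?A = "primitive D"
  obtain W F where flux: "flux_form ?A U W F" using stationary_profile_flux_form[OF D U] .
  note AU = flux_form_AE[OF flux] and W = flux_form_W[OF flux] and F = flux_form_F[OF flux]
  note A = primitive_mono[OF D] and mono = flux_form_mono[OF less D U flux]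
  define P where "P s \<longleftrightarrow> ?A (U s) = W s \<and> s \<noteq> 0 \<and> (\<forall>q\<in>\<rat>. W s = W q \<longrightarrow> F s = s / 2 * U s)" for s
  show ?thesis
  proof (rule ae_nondecreasingI)
    have "AE s in lebesgue. \<forall>q\<in>\<rat>. W s = W q \<longrightarrow> F s = s / 2 * U s"
      by (subst AE_ball_countable[OF countable_rat]) (intro ballI plateau_flux[OF W mono])
    moreover have "AE s in lebesgue. s \<noteq> (0::real)" by (intro AE_completion AE_lborel_singleton)
    ultimately show "AE s in lebesgue. P s" using AU unfolding P_def by eventually_elim blast
  next
    fix x y assume x: "P x" and y: "P y" and xy: "x < y"
    have Wxy: "W x \<le> W y" using monoD[OF mono] xy by simp
    show "U x \<le> U y"
    proof (cases "W x = W y")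
      case False
      then have "?A (U x) < ?A (U y)" using Wxy x y by (simp add: P_def)
      then show ?thesis using monoD[OF A, of "U y" "U x"] by (cases "U x \<le> U y") auto
    next
      case True
      obtain q where q: "q \<in> \<rat>" "x < q" "q < y" using Rats_dense_in_real[OF xy] by blast
      have "W x = W q" "W y = W q"
        using monoD[OF mono, of x q] monoD[OF mono, of q y] q True by auto
      then have "F x = x / 2 * U x" "F y = y / 2 * U y" using x y q by (auto simp: P_def)
      then have Ux: "U x = 2 * (F x / x)" and Uy: "U y = 2 * (F y / y)" using x y by (simp_all add: P_def field_simps)
      have "F x / x \<le> F y / y"
      proof (cases "0 \<in> {x..y}")
        case True
        then have "x < 0" "0 < y" using x y by (auto simp: P_def order_less_le)
        then show ?thesis by (rule plateau_across_origin[OF less D U flux _ _ \<open>W x = W y\<close>])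
      next
        case False
        then show ?thesis using plateau_ratio[OF W F mono _ True] xy by simp
      qed
      then show ?thesis by (simp add: Ux Uy)
    qed
  qed
qed

section \<open>Dependence on the diffusivity\<close>

lemma stationary_profile_bounds:
  assumes less: "Um < Up" and D: "admissible D" and U: "stationary_profile D Um Up U"
  shows "AE y in lebesgue. U y \<in> {Um..Up}"
proof -
  obtain V where V: "mono V" "AE y in lebesgue. U y = V y"
    using stationary_profile_nondecreasing[OF assms] by (auto simp: ae_nondecreasing_def)
  have "V a \<le> Up" for a
  proof (rule ccontr)
    assume "\<not> V a \<le> Up"
    moreover have "AE y in lebesgue. a \<le> y \<longrightarrow> V a - Up \<le> \<bar>U y - Up\<bar>"
      using V(2)
    proof eventually_elim
      case (elim y) then show ?case using monoD[OF V(1), of a y] by auto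
    qed
    ultimately show False using profile_right_limit[OF U, of "V a - Up" a] by simp
  qed
  moreover have "Um \<le> V a" for a
  proof (rule ccontr)
    assume "\<not> Um \<le> V a"
    moreover have "AE y in lebesgue. y \<le> a \<longrightarrow> Um - V a \<le> \<bar>U y - Um\<bar>"
      using V(2)
    proof eventually_elim
      case (elim y) then show ?case using monoD[OF V(1), of y a] by auto
    qed
    ultimately show False using profile_left_limit[OF U, of "Um - V a" a] by simp
  qed
  ultimately show ?thesis using V(2) by (auto elim: eventually_mono)
qed

text \<open>
  On \<open>[U\<^sub>-, U\<^sub>+]\<close> the two primitives differ by a constant \<open>c\<close>, and the second derivative of a test function
  has integral zero, so \<open>c\<close> drops out of the weak equation.
\<close>

lemma stationary_profile_cong:
  assumes less: "Um < Up" and D: "admissible D" and D': "admissible D'"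
    and eq: "\<And>s. s \<in> {Um..Up} \<Longrightarrow> D' s = D s" and U: "stationary_profile D Um Up U"
  shows "stationary_profile D' Um Up U"
proof -
  have "((\<lambda>u. primitive D' u - primitive D u) has_real_derivative 0) (at u within {Um..Up})"
    if "u \<in> {Um..Up}" for u
    using DERIV_diff[OF primitive_deriv[OF D', of u] primitive_deriv[OF D, of u]] eq[OF that]
    by (simp add: has_field_derivative_at_within)
  from has_field_derivative_zero_constant[OF _ this]
  obtain c where c: "\<And>u. u \<in> {Um..Up} \<Longrightarrow> primitive D' u - primitive D u = c"
    by (metis convex_real_interval(5))
  have ae: "AE y in lebesgue. primitive D' (U y) = primitive D (U y) + c"
    using stationary_profile_bounds[OF less D U] by eventually_elim (use c in force)
  have Ul: "locally_integrable U"
    using U by (auto simp: stationary_profile_def intro: L2_loc_locally_integrable)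
  note Al = primitive_locally_integrable[OF D Ul] and Al' = primitive_locally_integrable[OF D' Ul]
  have "(LINT y|lebesgue. primitive D' (U y) * deriv (deriv \<psi>) y - U y * deriv (\<lambda>z. z / 2 * \<psi> z) y) = 0"
    if \<psi>: "\<psi> \<in> Cc 2" for \<psi>
  proof -
    have \<psi>2: "\<psi> \<in> Cc (Suc (Suc 0))" using \<psi> by (simp add: numeral_2_eq_2)
    note \<psi>' = Cc_deriv[OF \<psi>2] and \<psi>'' = Cc_deriv[OF Cc_deriv[OF \<psi>2]]
    have dz: "deriv (\<lambda>z. z / 2 * \<psi> z) y = \<psi> y / 2 + y / 2 * deriv \<psi> y" for y
      by (rule DERIV_imp_deriv) (auto intro!: derivative_eq_intros Cc_Suc_deriv[OF \<psi>2])
    define T where "T y = U y * deriv (\<lambda>z. z / 2 * \<psi> z) y" for y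
    have T: "integrable lebesgue T"
    proof -
      have "integrable lebesgue (\<lambda>y. U y * (1/2) * \<psi> y + U y * (y / 2) * deriv \<psi> y)"
        by (intro Bochner_Integration.integrable_add integrable_test[OF _ \<psi>2] integrable_test[OF _ \<psi>']
            locally_integrable_mult_continuous[OF Ul] continuous_intros) auto
      then show ?thesis unfolding T_def dz by (simp add: algebra_simps)
    qed
    note i = integrable_test[OF Al \<psi>''] and i' = integrable_test[OF Al' \<psi>''] and i0 = integrable_test_only[OF \<psi>'']
    have z: "(LINT y|lebesgue. deriv (deriv \<psi>) y) = 0"
    proof -
      have "ac_primitive UNIV (\<lambda>_. 1) (\<lambda>_. 0)" by (rule ac_primitive_C1) auto
      from integral_by_parts_test[OF this _ \<psi>'] show ?thesis
        by (simp add: locally_integrable_continuous)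
    qed
    have "(LINT y|lebesgue. primitive D' (U y) * deriv (deriv \<psi>) y)
        = (LINT y|lebesgue. primitive D (U y) * deriv (deriv \<psi>) y + c * deriv (deriv \<psi>) y)"
    proof (rule integral_cong_AE)
      show "AE y in lebesgue. primitive D' (U y) * deriv (deriv \<psi>) y
          = primitive D (U y) * deriv (deriv \<psi>) y + c * deriv (deriv \<psi>) y"
        using ae by eventually_elim (simp add: algebra_simps)
    qed (use i i' i0 in auto)
    also have "\<dots> = (LINT y|lebesgue. primitive D (U y) * deriv (deriv \<psi>) y)"
      using i i0 z by simp
    finally have "(LINT y|lebesgue. primitive D' (U y) * deriv (deriv \<psi>) y - T y)
        = (LINT y|lebesgue. primitive D (U y) * deriv (deriv \<psi>) y - T y)"
      using i i' T by simp
    also have "\<dots> = 0" using U \<psi> by (simp add: stationary_profile_def T_def)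
    finally show ?thesis by (simp add: T_def)
  qed
  then show ?thesis using U by (simp add: stationary_profile_def)
qed

theorem lemma3p2:
  fixes Um Up :: real and D :: "real \<Rightarrow> real"
  assumes "Um < Up" and "admissible D"
  shows "(\<forall>U. stationary_profile D Um Up U \<longrightarrow> ae_nondecreasing U) \<and>
    (\<forall>D'. admissible D' \<and> (\<forall>s\<in>{Um..Up}. D' s = D s) \<longrightarrow>
       (\<forall>U. stationary_profile D Um Up U \<longleftrightarrow> stationary_profile D' Um Up U) \<and>
       (\<forall>U U'. stationary_profile D Um Up U \<and> stationary_profile D' Um Up U' \<longrightarrow>
          (AE y in lebesgue. U y = U' y)))"
proof (intro conjI allI impI)
  show "ae_nondecreasing U" if "stationary_profile D Um Up U" for U
    using stationary_profile_nondecreasing[OF assms that] .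
next
  fix D' U assume D': "admissible D' \<and> (\<forall>s\<in>{Um..Up}. D' s = D s)"
  show iff: "stationary_profile D Um Up U \<longleftrightarrow> stationary_profile D' Um Up U"
    using stationary_profile_cong[OF assms(1,2), of D' U] stationary_profile_cong[OF assms(1) _ assms(2), of D' U] D'
    by auto
next
  fix D' U U' assume D': "admissible D' \<and> (\<forall>s\<in>{Um..Up}. D' s = D s)"
    and U: "stationary_profile D Um Up U \<and> stationary_profile D' Um Up U'"
  then have "stationary_profile D Um Up U'"
    using stationary_profile_cong[OF assms(1) _ assms(2), of D' U'] by auto
  then show "AE y in lebesgue. U y = U' y"
    using stationary_profile_unique[OF assms(2)] U by blast
qed

end
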